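(* Consider a nonrelativistic quantum system with $n$ degrees of freedom and Hamiltonian $$H(\hat q,\hat p)=\tfrac12\hat p\cdot\mathbf M\hat p+\tfrac12\hat q\cdot\mathbf C\hat p+\tfrac12\hat p\cdot\mathbf C^\top\hat q+\hat p\cdot\xi_p+U(\hat q),$$ where $\mathbf M$ is a real, symmetric, positive definite $n\times n$ matrix, $\mathbf C$ is a real $n\times n$ matrix, $\xi_p\in\mathbb R^n$ and $U$ is a real function. Suppose the system is in a (possibly mixed) state with density operator $\hat\rho$, with spectral decomposition $\hat\rho=\sum_k\omega_k|\psi_k\rangle\langle\psi_k|$, $\omega_k\ge0$, $\sum_k\omega_k=1$. Write $\langle q|\hat\rho|q'\rangle=\bar\Omega(q,q',t)\exp[\tfrac{i}{\hbar}\bar S(q,q',t)]$ with $\bar\Omega=|\langle q|\hat\rho|q'\rangle|$, and define the mean value of the quantum potential of the mixed state $$\langle\bar Q(t)\rangle_\rho:=\int_{\mathbb R^n}d^nq\;\bar\Omega(q,q,t)\,\bar Q(q,q',t)\big|_{q'=q}=-\frac{\hbar^2}{2}\int_{\mathbb R^n}d^nq\;\partial_q\cdot\mathbf M\,\partial_q\bar\Omega(q,q',t)\big|_{q'=q},$$ where $\bar Q(q,q',t):=-\frac{\hbar^2}{2\bar\Omega}\partial_q\cdot\mathbf M\partial_q\bar\Omega$ (derivatives taken with respect to $q$ at fixed $q'$, then evaluated at $q'=q$). Then $$\langle\bar Q(t)\rangle_\rho\ \ge\ \frac{\hbar^2}{8}\sum_k\omega_k\,\lambda_\wedge\big((\mathbf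 V^{(k)})^{-1}\mathbf M\big),$$ where $\mathbf V^{(k)}$ is the position covariance matrix of the pure state $|\psi_k\rangle$ and $\lambda_\wedge$ denotes the largest eigenvalue.
   Context: $\partial_q=(\partial/\partial q_1,\dots,\partial/\partial q_n)^\top$. The function $\bar\Omega(q,q',t)$ is assumed continuous and twice continuously differentiable on $\mathbb R^{2n+1}$, vanishing as $\|q\|\to\infty$ or $\|q'\|\to\infty$, with $\int\bar\Omega(q,q,t)d^nq=1$; similarly each $\Omega_k=|\langle q|\psi_k\rangle|$ is assumed continuous, twice continuously differentiable, normalized and vanishing at infinity. The position covariance matrix of a state $\hat\sigma$ is $\mathbf V:=\mathrm{Tr}(\hat\sigma\hat q\hat q^\dagger)-\mathrm{Tr}(\hat\sigma\hat q)\mathrm{Tr}(\hat\sigma\hat q^\dagger)$, with $\hat q=(\hat q_1,\dots,\hat q_n)^\top$; $\mathbf V^{(k)}$ is this matrix for $\hat\sigma=|\psi_k\rangle\langle\psi_k|$ (it is positive definite). *)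

theory Defs
  imports "HOL-Analysis.Analysis"
begin

definition C2 :: "('a::euclidean_space \<Rightarrow> real) \<Rightarrow> bool" where
  "C2 f \<longleftrightarrow> (\<exists>Df :: 'a \<Rightarrow> ('a \<Rightarrow>\<^sub>L real). \<exists>DDf :: 'a \<Rightarrow> ('a \<Rightarrow>\<^sub>L ('a \<Rightarrow>\<^sub>L real)).
      (\<forall>x. (f has_derivative blinfun_apply (Df x)) (at x)) \<and>
      (\<forall>x. (Df has_derivative blinfun_apply (DDf x)) (at x)) \<and>
      continuous_on UNIV DDf)"

definition pd :: "'n::finite \<Rightarrow> (real^'n \<Rightarrow> real) \<Rightarrow> real^'n \<Rightarrow> real" where
  "pd i f x = deriv (\<lambda>t. f (x + t *\<^sub>R axis i 1)) 0"

definition M_laplacian :: "real^'n^'n \<Rightarrow> (real^'n \<Rightarrow> real) \<Rightarrow> real^'n \<Rightarrow> real" where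
  "M_laplacian M f x = (\<Sum>i\<in>UNIV. \<Sum>j\<in>UNIV. M $ i $ j * pd i (pd j f) x)"

definition sym_posdef :: "real^'n^'n \<Rightarrow> bool" where
  "sym_posdef A \<longleftrightarrow> transpose A = A \<and> (\<forall>x. x \<noteq> 0 \<longrightarrow> x \<bullet> (A *v x) > 0)"

definition pos_cov :: "(real^'n \<Rightarrow> complex) \<Rightarrow> real^'n^'n" where
  "pos_cov psi = (\<chi> i j.
      (LINT q|lborel. q $ i * q $ j * (cmod (psi q))\<^sup>2)
      - (LINT q|lborel. q $ i * (cmod (psi q))\<^sup>2) * (LINT q|lborel. q $ j * (cmod (psi q))\<^sup>2))"

definition real_eigenvalues :: "real^'n^'n \<Rightarrow> real set" where
  "real_eigenvalues A = {l. \<exists>v. v \<noteq> 0 \<and> A *v v = l *\<^sub>R v}"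

definition largest_eigenvalue :: "real^'n^'n \<Rightarrow> real" where
  "largest_eigenvalue A = Max (real_eigenvalues A)"

definition mean_quantum_potential ::
  "real \<Rightarrow> real^'n^'n \<Rightarrow> (real^'n \<Rightarrow> real^'n \<Rightarrow> real) \<Rightarrow> real" where
  "mean_quantum_potential hbar M Omb =
     - (hbar\<^sup>2 / 2) * (LINT q|lborel. M_laplacian M (\<lambda>y. Omb y q) q)"

end

theory Submission
  imports Defs
begin

text \<open>
  For a unit complex number \<open>c\<close> aligning the phase of \<open>\<rho>(x,y)\<close>, the series
  \<open>\<Sum>\<^sub>k \<omega>\<^sub>k |\<psi>\<^sub>k(x) - c \<psi>\<^sub>k(y)|\<^sup>2\<close> equals \<open>|\<rho>(x,x)| + |\<rho>(y,y)| - 2|\<rho>(x,y)|\<close> and dominates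
  \<open>\<Sum>\<^sub>k \<omega>\<^sub>k (|\<psi>\<^sub>k(x)| - |\<psi>\<^sub>k(y)|)\<^sup>2\<close>. With \<open>x = q \<plusminus> t r\<close> and \<open>y = q\<close> this bounds the second
  difference of \<open>|\<rho>(\<cdot>,q)|\<close> at \<open>q\<close> by half the second difference of the density \<open>|\<rho>(q,q)|\<close> minus
  squared differences of the \<open>|\<psi>\<^sub>k|\<close>, without any regularity of the phases. Integrate this against
  a compactly supported cutoff of radius \<open>R\<close>: translating the density term onto the cutoff makes it
  \<open>O(t\<^sup>2 / R\<^sup>2)\<close>, and a finite-difference Cramer-Rao inequality bounds the squared differences from
  below by \<open>t\<^sup>2 (w \<bullet> r)\<^sup>2 / (4 w \<bullet> V\<^sup>(\<^sup>k\<^sup>) w)\<close> up to errors that vanish as \<open>t \<rightarrow> 0\<close> and then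
  \<open>R \<rightarrow> \<infinity>\<close>. Writing \<open>M = \<Sum>\<^sub>l r\<^sub>l r\<^sub>l\<^sup>T\<close>, taking for \<open>w\<close> an eigenvector with \<open>M w = \<lambda> V\<^sup>(\<^sup>k\<^sup>) w\<close> and
  summing over \<open>l\<close> gives \<open>\<lambda> / 4\<close> for each \<open>k\<close>.
\<close>

section \<open>Positive definite matrices\<close>

lemma inner_matrix_vector_commute:
  fixes A :: "real^'n^'n"
  assumes "transpose A = A"
  shows "x \<bullet> (A *v y) = y \<bullet> (A *v x)"
  by (metis assms dot_lmul_matrix inner_commute transpose_matrix_vector)

lemma inner_axis_matrix_axis: "axis i 1 \<bullet> (A *v axis j 1) = A $ i $ j" for A :: "real^'n^'n"
  by (simp add: matrix_vector_mult_basis column_def inner_axis')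

text \<open>Moving from \<open>v\<close> by \<open>t\<close> times \<open>A *v v\<close> changes the
  form by \<open>2 t |A v|^2\<close> to first order. If \<open>A *v v\<close> were nonzero, a
  suitable negative \<open>t\<close> would therefore make the form negative.\<close>

lemma psd_kernel:
  fixes A :: "real^'n^'n"
  assumes sym: "transpose A = A" and psd: "\<And>x. 0 \<le> x \<bullet> (A *v x)" and null: "v \<bullet> (A *v v) = 0"
  shows "A *v v = 0"
proof (rule ccontr)
  let ?y = "A *v v"
  assume "?y \<noteq> 0"
  then have a: "?y \<bullet> ?y > 0" by simp
  define b where "b = ?y \<bullet> (A *v ?y)"
  \<comment> \<open>This is the minimiser of \<open>2 t (?y . ?y) + t^2 (b + 1)\<close>; the added
    \<open>1\<close> keeps the denominator positive when \<open>b = 0\<close>.\<close>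
  define t where "t = - (?y \<bullet> ?y) / (b + 1)"
  have b: "b \<ge> 0" unfolding b_def by (rule psd)
  have "0 \<le> (v + t *\<^sub>R ?y) \<bullet> (A *v (v + t *\<^sub>R ?y))" by (rule psd)
  also have "\<dots> = 2 * t * (?y \<bullet> ?y) + t\<^sup>2 * b"
    using null inner_matrix_vector_commute[OF sym, of v ?y]
    by (simp add: b_def matrix_vector_right_distrib matrix_vector_mult_scaleR inner_add_left
        inner_add_right power2_eq_square algebra_simps)
  also have "\<dots> \<le> 2 * t * (?y \<bullet> ?y) + t\<^sup>2 * (b + 1)"
    by (intro add_left_mono mult_left_mono) auto
  also have "\<dots> = - ((?y \<bullet> ?y)\<^sup>2 / (b + 1))"
  proof -
    have "2 * (- p / c) * p + (- p / c)\<^sup>2 * c = - (p\<^sup>2 / c)" if "c > 0" for p c :: real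
      using that by (simp add: field_simps power2_eq_square)
    then show ?thesis using b by (simp add: t_def)
  qed
  also have "\<dots> < 0"
    using a b by simp
  finally show False by simp
qed

text \<open>Symmetric Gaussian elimination, as in the Cholesky factorisation: removing a rank one
  matrix at a nonzero pivot leaves a positive semidefinite Schur complement with fewer nonzero
  diagonal entries, which is the quantity of the induction.\<close>

lemma psd_sum_of_rank_one:
  fixes A :: "real^'n^'n"
  assumes "transpose A = A" and "\<And>x. 0 \<le> x \<bullet> (A *v x)"
  shows "\<exists>(m::nat) r. \<forall>i j. A $ i $ j = (\<Sum>l<m. r l $ i * r l $ j)"
  using assms
proof (induction "card {i. A $ i $ i \<noteq> 0}" arbitrary: A rule: less_induct)
  case less
  note sym = less.prems(1) and psd = less.prems(2)
  have symc: "A $ i $ j = A $ j $ i" for i j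
    using sym by (metis transpose_def vec_lambda_beta)
  show ?case
  proof (cases "\<exists>k. A $ k $ k \<noteq> 0")
    \<comment> \<open>With a zero diagonal every basis vector is null for the form, so
      \<open>psd_kernel\<close> kills every column and the empty sum represents
      \<open>A\<close>.\<close>
    case False
    have "A $ i $ j = 0" for i j
    proof -
      have "A *v axis j 1 = 0"
        by (rule psd_kernel[OF sym psd]) (use False in \<open>simp add: inner_axis_matrix_axis\<close>)
      then show ?thesis using inner_axis_matrix_axis[of i A j] by simp
    qed
    then show ?thesis by (intro exI[of _ 0]) simp
  next
    case True
    then obtain k where k: "A $ k $ k \<noteq> 0" by blast
    have d: "0 \<le> A $ i $ i" for i using psd[of "axis i 1"] by (simp add: inner_axis_matrix_axis)
    have kp: "A $ k $ k > 0" using k d[of k] by simp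
    define a where "a = A *v axis k 1"
    have ai: "a $ i = A $ i $ k" for i
      by (simp add: a_def matrix_vector_mult_basis column_def)
    define B where "B = (\<chi> i j. A $ i $ j - a $ i * a $ j / A $ k $ k)"
    have Bx: "x \<bullet> (B *v x) = x \<bullet> (A *v x) - (x \<bullet> a)\<^sup>2 / A $ k $ k" for x
      unfolding B_def inner_vec_def matrix_vector_mult_def
      by (simp add: power2_eq_square sum_distrib_left sum_distrib_right sum_subtractf
          left_diff_distrib right_diff_distrib sum_divide_distrib mult_ac)
    have psdB: "0 \<le> x \<bullet> (B *v x)" for x
    proof -
      \<comment> \<open>\<open>c\<close> minimises the form along the line through \<open>x\<close>
        in the direction of the pivot axis, and the minimum is exactly the value of the reduced form
        \<open>B\<close> at \<open>x\<close>.\<close>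
      define c where "c = (x \<bullet> a) / A $ k $ k"
      have "0 \<le> (x - c *\<^sub>R axis k 1) \<bullet> (A *v (x - c *\<^sub>R axis k 1))" by (rule psd)
      also have "\<dots> = x \<bullet> (A *v x) - 2 * c * (x \<bullet> a) + c\<^sup>2 * A $ k $ k"
        using inner_matrix_vector_commute[OF sym, of x "axis k 1"]
        by (simp add: a_def matrix_vector_mult_diff_distrib matrix_vector_mult_scaleR inner_diff_left
            inner_diff_right power2_eq_square inner_axis_matrix_axis algebra_simps)
      also have "\<dots> = x \<bullet> (B *v x)"
        using kp by (simp add: Bx c_def field_simps power2_eq_square)
      finally show ?thesis .
    qed
    have symB: "transpose B = B"
      unfolding transpose_def B_def vec_eq_iff by (simp add: symc mult.commute)
    \<comment> \<open>Diagonal entries only decrease and stay nonnegative, so zeros persist while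
      the pivot entry becomes a new zero.\<close>
    have "B $ i $ i \<le> A $ i $ i" for i
      using kp by (simp add: B_def)
    moreover have "0 \<le> B $ i $ i" for i
      using psdB[of "axis i 1"] by (simp add: inner_axis_matrix_axis)
    ultimately have "A $ i $ i = 0 \<Longrightarrow> B $ i $ i = 0" for i
      by (metis order_antisym)
    moreover have "B $ k $ k = 0" using kp by (simp add: B_def ai)
    ultimately have "{i. B $ i $ i \<noteq> 0} \<subset> {i. A $ i $ i \<noteq> 0}" using k by blast
    then have "card {i. B $ i $ i \<noteq> 0} < card {i. A $ i $ i \<noteq> 0}"
      by (intro psubset_card_mono) auto
    from less.hyps[OF this symB psdB] obtain m r
      where r: "\<And>i j. B $ i $ j = (\<Sum>l<(m::nat). r l $ i * r l $ j)" by blast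
    define r' where "r' = r(m := (1 / sqrt (A $ k $ k)) *\<^sub>R a)"
    have "A $ i $ j = (\<Sum>l<Suc m. r' l $ i * r' l $ j)" for i j
    proof -
      have "(\<Sum>l<m. r' l $ i * r' l $ j) = B $ i $ j"
        unfolding r by (rule sum.cong) (auto simp: r'_def)
      then show ?thesis using kp by (simp add: r'_def B_def)
    qed
    then show ?thesis by blast
  qed
qed

text \<open>\<open>largest_eigenvalue\<close> is a \<open>Max\<close>, which says something only for
  a finite nonempty set. Both properties are proved for the generalized problem
  \<open>M v = l V v\<close>, where both matrices are symmetric although
  \<open>matrix_inv V ** M\<close> need not be.\<close>

lemma largest_eigenvalue_generalized:
  fixes M V :: "real^'n^'n"
  assumes M: "sym_posdef M" and V: "sym_posdef V"
  obtains v where "v \<noteq> 0" "M *v v = largest_eigenvalue (matrix_inv V ** M) *\<^sub>R (V *v v)"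
    "largest_eigenvalue (matrix_inv V ** M) > 0"
proof -
  have symM: "transpose M = M" and posM: "x \<noteq> 0 \<Longrightarrow> x \<bullet> (M *v x) > 0" for x
    using M by (auto simp: sym_posdef_def)
  have symV: "transpose V = V" and posV: "x \<noteq> 0 \<Longrightarrow> x \<bullet> (V *v x) > 0" for x
    using V by (auto simp: sym_posdef_def)
  have "invertible V"
    unfolding invertible_left_inverse matrix_left_invertible_ker using posV by fastforce
  then have inv: "V ** matrix_inv V = mat 1 \<and> matrix_inv V ** V = mat 1"
    unfolding invertible_def matrix_inv_def by (rule someI_ex)
  have eig: "real_eigenvalues (matrix_inv V ** M) = {l. \<exists>v. v \<noteq> 0 \<and> M *v v = l *\<^sub>R (V *v v)}"
  proof -
    have "(matrix_inv V ** M) *v v = l *\<^sub>R v \<longleftrightarrow> M *v v = l *\<^sub>R (V *v v)" for l v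
    proof
      assume "(matrix_inv V ** M) *v v = l *\<^sub>R v"
      then have "V *v (matrix_inv V *v (M *v v)) = V *v (l *\<^sub>R v)"
        by (simp add: matrix_vector_mul_assoc)
      then show "M *v v = l *\<^sub>R (V *v v)"
        using inv by (simp add: matrix_vector_mul_assoc matrix_mul_assoc matrix_vector_mult_scaleR)
    next
      assume "M *v v = l *\<^sub>R (V *v v)"
      then have "matrix_inv V *v (M *v v) = matrix_inv V *v (V *v (l *\<^sub>R v))"
        by (simp add: matrix_vector_mult_scaleR)
      then show "(matrix_inv V ** M) *v v = l *\<^sub>R v"
        using inv by (simp add: matrix_vector_mul_assoc)
    qed
    then show ?thesis by (simp add: real_eigenvalues_def)
  qed
  let ?E = "{l. \<exists>v. v \<noteq> 0 \<and> M *v v = l *\<^sub>R (V *v v)}"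
  have pos: "l > 0" if "v \<noteq> 0" "M *v v = l *\<^sub>R (V *v v)" for l v
    using posM[OF that(1)] posV[OF that(1)] that(2) by (simp add: zero_less_mult_iff)
  \<comment> \<open>Eigenvectors for different eigenvalues are orthogonal with respect to the inner
    product of \<open>V\<close>, hence linearly independent, so the dimension bounds their
    number.\<close>
  have fin: "finite ?E"
  proof -
    define w where "w l = (SOME v. v \<noteq> 0 \<and> M *v v = l *\<^sub>R (V *v v))" for l
    have w: "w l \<noteq> 0" "M *v w l = l *\<^sub>R (V *v w l)" if "l \<in> ?E" for l
      using that unfolding w_def mem_Collect_eq by (metis (mono_tags, lifting) someI_ex)+
    have orth: "w l \<bullet> (V *v w k) = 0" if "l \<in> ?E" "k \<in> ?E" "l \<noteq> k" for l k
    proof -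
      have "w l \<bullet> (M *v w k) = w k \<bullet> (M *v w l)" by (rule inner_matrix_vector_commute[OF symM])
      then have "k * (w l \<bullet> (V *v w k)) = l * (w k \<bullet> (V *v w l))"
        using w that by simp
      then show ?thesis
        using inner_matrix_vector_commute[OF symV, of "w l" "w k"] that(3) by simp
    qed
    have inj: "inj_on w ?E"
    proof (rule inj_onI, rule ccontr)
      fix l k assume lk: "l \<in> ?E" "k \<in> ?E" "w l = w k" "l \<noteq> k"
      show False using orth[OF lk(1,2,4)] posV[OF w(1)[OF lk(1)]] lk(3) by simp
    qed
    have "independent (w ` ?E)"
      unfolding independent_explicit_module
    proof (intro allI impI)
      fix T u v
      assume T: "finite T" "T \<subseteq> w ` ?E" "(\<Sum>v\<in>T. u v *\<^sub>R v) = 0" "v \<in> T"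
      have o: "x \<bullet> (V *v v) = 0" if "x \<in> T" "x \<noteq> v" for x
        using that T(2,4) orth by blast
      have "0 = (\<Sum>x\<in>T. u x *\<^sub>R x) \<bullet> (V *v v)" using T(3) by simp
      also have "\<dots> = (\<Sum>x\<in>T. u x * (x \<bullet> (V *v v)))" by (simp add: inner_sum_left)
      also have "\<dots> = u v * (v \<bullet> (V *v v))"
        using T(1,4) o by (subst sum.remove[of _ v]) (auto intro!: sum.neutral)
      finally show "u v = 0" using posV[of v] T(2,4) w(1) by force
    qed
    then have "finite (w ` ?E)" using independent_bound by blast
    then show ?thesis using inj finite_imageD by blast
  qed
  \<comment> \<open>The maximum \<open>l\<close> of the Rayleigh quotient is an eigenvalue:
    \<open>l V - M\<close> is positive semidefinite with the maximiser as a null vector, so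
    \<open>psd_kernel\<close> applies.\<close>
  have ne: "?E \<noteq> {}"
  proof -
    let ?S = "sphere (0::real^'n) 1"
    let ?g = "\<lambda>x. (x \<bullet> (M *v x)) / (x \<bullet> (V *v x))"
    have "axis undefined 1 \<in> ?S" by simp
    then have "?S \<noteq> {}" by blast
    moreover have "continuous_on ?S ?g"
    proof (intro continuous_intros matrix_vector_mult_linear_continuous_on ballI)
      fix x assume "x \<in> ?S"
      then show "x \<bullet> (V *v x) \<noteq> 0" using posV[of x] by (cases "x = 0") auto
    qed
    ultimately obtain v where v: "v \<in> ?S" "\<And>y. y \<in> ?S \<Longrightarrow> ?g y \<le> ?g v"
      using continuous_attains_sup[OF compact_sphere] by blast
    have v0: "v \<noteq> 0" using v(1) by auto
    define l where "l = ?g v"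
    define N where "N = l *\<^sub>R V - M"
    have Nx: "N *v x = l *\<^sub>R (V *v x) - M *v x" for x
      by (simp add: N_def matrix_vector_mult_diff_rdistrib scaleR_matrix_vector_assoc)
    have "transpose N = N"
      using symM symV by (simp add: N_def transpose_def vec_eq_iff)
    moreover have "0 \<le> x \<bullet> (N *v x)" for x
    proof (cases "x = 0")
      case False
      have "?g (sgn x) \<le> l" unfolding l_def by (rule v(2)) (use False in \<open>simp add: norm_sgn\<close>)
      moreover have "?g (sgn x) = ?g x"
        using False by (simp add: sgn_div_norm matrix_vector_mult_scaleR)
      ultimately show ?thesis
        using posV[OF False] by (simp add: Nx inner_diff_right field_simps)
    qed simp
    moreover have "v \<bullet> (N *v v) = 0"
      using posV[OF v0] by (simp add: Nx inner_diff_right l_def)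
    ultimately have "N *v v = 0" by (rule psd_kernel)
    then have "M *v v = l *\<^sub>R (V *v v)" by (simp add: Nx)
    then show ?thesis using v0 by blast
  qed
  have "largest_eigenvalue (matrix_inv V ** M) \<in> ?E"
    unfolding largest_eigenvalue_def eig by (rule Max_in[OF fin ne])
  then show ?thesis using pos that by blast
qed

section \<open>Translation and cutoff\<close>

lemma lborel_integrable_translation:
  fixes f :: "'a::euclidean_space \<Rightarrow> 'b::{banach, second_countable_topology}"
  assumes "integrable lborel f"
  shows "integrable lborel (\<lambda>x. f (x + h))"
proof -
  have "integrable (distr lborel borel ((+) h)) f"
    using assms by (simp add: lborel_distr_plus)
  then show ?thesis
    using assms by (subst (asm) integrable_distr_eq) (auto simp: add.commute)
qed

lemma lborel_integral_translation:
  fixes f :: "'a::euclidean_space \<Rightarrow> 'b::{banach, second_countable_topology}"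
  assumes "integrable lborel f"
  shows "(LINT x|lborel. f (x + h)) = (LINT x|lborel. f x)"
proof -
  have "(LINT x|lborel. f x) = (LINT x|distr lborel borel ((+) h). f x)"
    by (simp add: lborel_distr_plus)
  also have "\<dots> = (LINT x|lborel. f (h + x))"
    using assms by (intro integral_distr) auto
  finally show ?thesis by (simp add: add.commute)
qed

text \<open>Squaring the truncated parabola makes the function continuously differentiable across
  the sphere of radius \<open>R\<close>. It is not twice differentiable there, but its second
  differences are bounded above by a multiple of \<open>(|h| / R)^2\<close>, which is the smoothness
  that the translation argument uses.\<close>

definition cutoff :: "real \<Rightarrow> 'a::real_inner \<Rightarrow> real" where
  "cutoff R x = (max 0 (1 - (norm x / R)\<^sup>2))\<^sup>2"

lemma cutoff_nonneg: "0 \<le> cutoff R x"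
  by (simp add: cutoff_def)

lemma cutoff_le_1: "cutoff R x \<le> 1"
  unfolding cutoff_def by (rule power_le_one) auto

lemma cutoff_eq_0: "R > 0 \<Longrightarrow> norm x \<ge> R \<Longrightarrow> cutoff R x = 0"
  by (simp add: cutoff_def divide_simps)

lemma continuous_on_cutoff [continuous_intros]:
  "continuous_on S f \<Longrightarrow> continuous_on S (\<lambda>x. cutoff R (f x))"
  unfolding cutoff_def divide_inverse by (intro continuous_intros)

lemma borel_measurable_cutoff [measurable]:
  "cutoff R \<in> borel_measurable (borel :: 'a::euclidean_space measure)"
  by (intro borel_measurable_continuous_onI continuous_intros)

lemma cutoff_tendsto_1: "(\<lambda>n. cutoff (real (Suc n)) x) \<longlonglongrightarrow> 1"
proof -
  have "(\<lambda>n. (max 0 (1 - (norm x / real (Suc n))\<^sup>2))\<^sup>2) \<longlonglongrightarrow> (max 0 (1 - 0\<^sup>2))\<^sup>2"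
    by (intro tendsto_intros LIMSEQ_Suc[OF lim_const_over_n])
  then show ?thesis by (simp add: cutoff_def)
qed

text \<open>The cutoff is \<open>(1 - g^2)^2\<close> with \<open>g = min 1 (norm x / R)\<close>.
  Squaring is Lipschitz with constant 2 on the unit interval and is applied twice, which gives the
  factor 4.\<close>

lemma cutoff_lipschitz:
  assumes R: "R > 0"
  shows "\<bar>cutoff R x - cutoff R y\<bar> \<le> 4 / R * norm (x - y)"
proof -
  define g where "g x = min 1 (norm x / R)" for x :: 'a
  have g: "0 \<le> g x" "g x \<le> 1" for x using R by (auto simp: g_def)
  have c: "cutoff R x = (1 - (g x)\<^sup>2)\<^sup>2" for x
  proof (cases "norm x / R \<le> 1")
    case True
    then have "(norm x / R)\<^sup>2 \<le> 1" using R by (intro power_le_one) auto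
    then show ?thesis using True by (simp add: cutoff_def g_def)
  next
    case False
    then have "1 \<le> (norm x / R)\<^sup>2" using R by (intro one_le_power) auto
    then show ?thesis using False by (simp add: cutoff_def g_def)
  qed
  have sq: "\<bar>a\<^sup>2 - b\<^sup>2\<bar> \<le> 2 * \<bar>a - b\<bar>" if "0 \<le> a" "a \<le> 1" "0 \<le> b" "b \<le> 1" for a b :: real
  proof -
    have "\<bar>a\<^sup>2 - b\<^sup>2\<bar> = \<bar>a + b\<bar> * \<bar>a - b\<bar>"
      by (simp add: power2_eq_square flip: abs_mult) (simp add: algebra_simps)
    also have "\<dots> \<le> 2 * \<bar>a - b\<bar>" using that by (intro mult_right_mono) auto
    finally show ?thesis .
  qed
  have g1: "(g x)\<^sup>2 \<le> 1" for x using g by (intro power_le_one)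
  have "\<bar>cutoff R x - cutoff R y\<bar> \<le> 2 * \<bar>(1 - (g x)\<^sup>2) - (1 - (g y)\<^sup>2)\<bar>"
    unfolding c using g1 by (intro sq) auto
  also have "\<dots> = 2 * \<bar>(g x)\<^sup>2 - (g y)\<^sup>2\<bar>" by simp
  also have "\<dots> \<le> 2 * (2 * \<bar>g x - g y\<bar>)" using g by (intro mult_left_mono sq) auto
  also have "\<bar>g x - g y\<bar> \<le> \<bar>norm x / R - norm y / R\<bar>" by (simp add: g_def min_def)
  also have "\<dots> = \<bar>norm x - norm y\<bar> / R" using R by (simp flip: diff_divide_distrib)
  also have "\<dots> \<le> norm (x - y) / R"
    using R by (intro divide_right_mono norm_triangle_ineq3) auto
  finally show ?thesis by simp
qed

text \<open>After rescaling to radius 1, the terms linear in \<open>k\<close> cancel and the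
  remaining tangent term is nonpositive, so only squares of increments count. They contribute
  \<open>8 * 4 + 2 = 34\<close> when \<open>norm y\<close> is at most 2; for larger
  \<open>norm y\<close> all three values vanish.\<close>

lemma cutoff_second_difference:
  assumes R: "R > 0" and h: "norm h \<le> R"
  shows "cutoff R (x + h) + cutoff R (x - h) - 2 * cutoff R x \<le> 34 * (norm h / R)\<^sup>2"
proof -
  define y where "y = x /\<^sub>R R"
  define k where "k = h /\<^sub>R R"
  define s where "s z = 1 - z \<bullet> z" for z :: 'a
  have cs: "cutoff R z = (max 0 (s (z /\<^sub>R R)))\<^sup>2" for z
    using R by (simp add: cutoff_def s_def divide_inverse power2_norm_eq_inner [symmetric]
        power_mult_distrib mult.commute)
  have k1: "norm k \<le> 1" and nk: "norm k = norm h / R"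
    using R h by (auto simp: k_def divide_simps)
  have eqs: "(x + h) /\<^sub>R R = y + k" "(x - h) /\<^sub>R R = y - k"
    by (auto simp: y_def k_def scaleR_add_right scaleR_diff_right)
  \<comment> \<open>A second-order upper expansion of the squared positive part that remains valid
    across the kink at zero.\<close>
  have sq: "(max 0 b)\<^sup>2 \<le> (max 0 a)\<^sup>2 + 2 * max 0 a * (b - a) + (b - a)\<^sup>2" for a b :: real
  proof (cases "a \<ge> 0")
    case True
    then have "(max 0 a)\<^sup>2 + 2 * max 0 a * (b - a) + (b - a)\<^sup>2 = b\<^sup>2"
      by (simp add: power2_eq_square algebra_simps)
    then show ?thesis by (auto simp: max_def)
  next
    case False
    then have "(max 0 b)\<^sup>2 \<le> (b - a)\<^sup>2"
      by (cases "b \<ge> 0") (auto intro!: power_mono)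
    then show ?thesis using False by simp
  qed
  have "(max 0 (s (y + k)))\<^sup>2 + (max 0 (s (y - k)))\<^sup>2 - 2 * (max 0 (s y))\<^sup>2 \<le> 34 * (norm k)\<^sup>2"
  proof (cases "norm y \<le> 2")
    case True
    let ?a = "max 0 (s y)"
    have d: "s (y + k) - s y = - (2 * (y \<bullet> k) + k \<bullet> k)" "s (y - k) - s y = 2 * (y \<bullet> k) - k \<bullet> k"
      by (auto simp: s_def inner_add_left inner_add_right inner_diff_left inner_diff_right inner_commute)
    have "(max 0 (s (y + k)))\<^sup>2 + (max 0 (s (y - k)))\<^sup>2 - 2 * ?a\<^sup>2
        \<le> 2 * ?a * (s (y + k) - s y) + (s (y + k) - s y)\<^sup>2
          + (2 * ?a * (s (y - k) - s y) + (s (y - k) - s y)\<^sup>2)"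
      using sq[of "s (y + k)" "s y"] sq[of "s (y - k)" "s y"] by linarith
    also have "\<dots> = - (4 * ?a * (k \<bullet> k)) + 8 * (y \<bullet> k)\<^sup>2 + 2 * (k \<bullet> k)\<^sup>2"
      unfolding d by (simp add: power2_eq_square algebra_simps)
    also have "\<dots> \<le> 8 * (y \<bullet> k)\<^sup>2 + 2 * (k \<bullet> k)\<^sup>2" by simp
    also have "\<dots> \<le> 8 * (4 * (norm k)\<^sup>2) + 2 * (norm k)\<^sup>2"
    proof (intro add_mono mult_left_mono)
      have "(y \<bullet> k)\<^sup>2 \<le> (norm y * norm k)\<^sup>2"
        using Cauchy_Schwarz_ineq2[of y k] by (metis abs_ge_zero power2_abs power_mono)
      also have "\<dots> \<le> (2 * norm k)\<^sup>2" using True by (intro power_mono mult_right_mono) auto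
      finally show "(y \<bullet> k)\<^sup>2 \<le> 4 * (norm k)\<^sup>2" by (simp add: power_mult_distrib)
      have "(norm k)\<^sup>2 * (norm k)\<^sup>2 \<le> 1 * (norm k)\<^sup>2"
        using k1 by (intro mult_right_mono power_le_one) auto
      then show "(k \<bullet> k)\<^sup>2 \<le> (norm k)\<^sup>2"
        by (simp add: power2_norm_eq_inner power2_eq_square[of "k \<bullet> k"])
    qed auto
    finally show ?thesis by simp
  next
    case False
    have s0: "max 0 (s z) = 0" if "norm z \<ge> 1" for z
      using that one_le_power[OF that, of 2] by (simp add: s_def power2_norm_eq_inner)
    have "norm (y + k) \<ge> 1" "norm (y - k) \<ge> 1" "norm y \<ge> 1"
      using False k1 norm_triangle_ineq2[of y "- k"] norm_triangle_ineq2[of y k] by auto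
    then show ?thesis by (simp add: s0)
  qed
  then show ?thesis by (simp add: cs eqs nk y_def [symmetric])
qed

section \<open>Second differences of twice differentiable functions\<close>

text \<open>Maclaurin's formula of order two for the even function
  \<open>F (z + s v) + F (z - s v)\<close> of \<open>s\<close>, whose first derivative vanishes at
  zero.\<close>

lemma second_difference_eq:
  fixes F :: "'a::real_normed_vector \<Rightarrow> real"
  assumes D: "\<And>x. (F has_derivative blinfun_apply (DF x)) (at x)"
    and DD: "\<And>x. (DF has_derivative blinfun_apply (DDF x)) (at x)"
    and t: "t > 0"
  obtains \<xi> where "0 < \<xi>" "\<xi> < t"
    "F (z + t *\<^sub>R v) + F (z - t *\<^sub>R v) - 2 * F z
       = t\<^sup>2 * ((DDF (z + \<xi> *\<^sub>R v) v v + DDF (z - \<xi> *\<^sub>R v) v v) / 2)"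
proof -
  define diff :: "nat \<Rightarrow> real \<Rightarrow> real" where
    "diff m = (if m = 0 then (\<lambda>s. F (z + s *\<^sub>R v) + F (z - s *\<^sub>R v))
       else if m = 1 then (\<lambda>s. DF (z + s *\<^sub>R v) v - DF (z - s *\<^sub>R v) v)
       else (\<lambda>s. DDF (z + s *\<^sub>R v) v v + DDF (z - s *\<^sub>R v) v v))" for m
  have line: "((\<lambda>s. z + s *\<^sub>R u) has_derivative (\<lambda>s. s *\<^sub>R u)) (at s)" for u :: 'a and s :: real
    by (auto intro!: derivative_eq_intros)
  have F1: "((\<lambda>s. F (z + s *\<^sub>R u)) has_real_derivative DF (z + s *\<^sub>R u) u) (at s)" for u s
    using has_derivative_compose[OF line D]
    by (simp add: has_field_derivative_def blinfun.scaleR_right mult_commute_abs)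
  have F2: "((\<lambda>s. F (z - s *\<^sub>R v)) has_real_derivative - DF (z - s *\<^sub>R v) v) (at s)" for s
    using F1[of "- v" s] by (simp add: blinfun.minus_right)
  have G1: "((\<lambda>s. DF (z + s *\<^sub>R u) v) has_real_derivative DDF (z + s *\<^sub>R u) u v) (at s)" for u s
    using bounded_linear.has_derivative[OF blinfun.bounded_linear_left has_derivative_compose[OF line DD]]
    by (simp add: has_field_derivative_def blinfun.scaleR_right blinfun.scaleR_left mult_commute_abs)
  have G2: "((\<lambda>s. DF (z - s *\<^sub>R v) v) has_real_derivative - DDF (z - s *\<^sub>R v) v v) (at s)" for s
    using G1[of "- v" s] by (simp add: blinfun.minus_right blinfun.minus_left)
  have "DERIV (diff m) s :> diff (Suc m) s" if m: "m < 2" for m s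
  proof -
    consider "m = 0" | "m = 1" using less_2_cases[OF m] by auto
    then show ?thesis
    proof cases
      case 1
      then show ?thesis using DERIV_add[OF F1[where u = v and s = s] F2[of s]] by (simp add: diff_def)
    next
      case 2
      then show ?thesis using DERIV_diff[OF G1[where u = v and s = s] G2[of s]] by (simp add: diff_def)
    qed
  qed
  then obtain \<xi> where "0 < \<xi>" "\<xi> < t"
    "diff 0 t = (\<Sum>m<2. diff m 0 / fact m * t ^ m) + diff 2 \<xi> / fact 2 * t ^ 2"
    using Maclaurin[OF t, of 2 diff "diff 0"] by auto
  then show ?thesis
    by (intro that[of \<xi>]) (auto simp: diff_def numeral_2_eq_2)
qed

lemma pd_eq_derivative:
  fixes f :: "real^'n \<Rightarrow> real"
  assumes "(f has_derivative f') (at x)"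
  shows "pd i f x = f' (axis i 1)"
proof -
  have lin: "linear f'" by (rule has_derivative_linear[OF assms])
  have "((\<lambda>t. f (x + t *\<^sub>R axis i 1)) has_derivative (\<lambda>t. f' (t *\<^sub>R axis i 1))) (at 0)"
    by (rule has_derivative_compose[of "\<lambda>t. x + t *\<^sub>R axis i 1" _ _ _ f])
      (auto intro!: derivative_eq_intros simp: assms)
  then have "((\<lambda>t. f (x + t *\<^sub>R axis i 1)) has_real_derivative f' (axis i 1)) (at 0)"
    by (simp add: has_field_derivative_def linear_scale[OF lin] mult_commute_abs)
  then show ?thesis unfolding pd_def by (rule DERIV_imp_deriv)
qed

text \<open>Freezing \<open>q\<close> means differentiating \<open>F\<close> in directions
  \<open>(h, 0)\<close>. Bilinearity of the second derivative then turns the factorisation of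
  \<open>M\<close> into pure second derivatives along the \<open>r l\<close>, to which
  one-dimensional second differences apply.\<close>

lemma M_laplacian_eq_sum_second_derivatives:
  fixes F :: "(real^'n) \<times> 'b::real_normed_vector \<Rightarrow> real"
  assumes D: "\<And>z. (F has_derivative blinfun_apply (DF z)) (at z)"
    and DD: "\<And>z. (DF has_derivative blinfun_apply (DDF z)) (at z)"
    and r: "\<And>i j. M $ i $ j = (\<Sum>l<(m::nat). r l $ i * r l $ j)"
  shows "M_laplacian M (\<lambda>y. F (y, q)) x = (\<Sum>l<m. DDF (x, q) (r l, 0) (r l, 0))"
proof -
  have 1: "pd j (\<lambda>y. F (y, q)) = (\<lambda>y. DF (y, q) (axis j 1, 0))" for j
  proof
    fix y
    have "((\<lambda>y. F (y, q)) has_derivative (\<lambda>h. DF (y, q) (h, 0))) (at y)"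
      by (rule has_derivative_compose[of "\<lambda>y. (y, q)" _ _ _ F, OF _ D])
        (auto intro!: derivative_eq_intros)
    from pd_eq_derivative[OF this] show "pd j (\<lambda>y. F (y, q)) y = DF (y, q) (axis j 1, 0)" .
  qed
  have 2: "pd i (\<lambda>y. DF (y, q) (axis j 1, 0)) x = DDF (x, q) (axis i 1, 0) (axis j 1, 0)" for i j
  proof -
    have "((\<lambda>y. DF (y, q)) has_derivative (\<lambda>h. DDF (x, q) (h, 0))) (at x)"
      by (rule has_derivative_compose[of "\<lambda>y. (y, q)" _ _ _ DF, OF _ DD])
        (auto intro!: derivative_eq_intros)
    from bounded_linear.has_derivative[OF blinfun.bounded_linear_left this, of "(axis j 1, 0)"]
    show ?thesis by (rule pd_eq_derivative)
  qed
  have 3: "DDF z (u, 0) (u, 0)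
      = (\<Sum>i\<in>UNIV. \<Sum>j\<in>UNIV. u $ i * u $ j * DDF z (axis i 1, 0) (axis j 1, 0))" for z and u :: "real^'n"
  proof -
    define e where "e i = (axis i 1 :: real^'n, 0 :: 'b)" for i
    have u: "(u, 0) = (\<Sum>i\<in>UNIV. u $ i *\<^sub>R e i)"
      by (simp add: e_def prod_eq_iff fst_sum snd_sum)
        (metis (no_types) basis_expansion scalar_mult_eq_scaleR)
    have left: "DDF z (u, 0) w = (\<Sum>i\<in>UNIV. u $ i * DDF z (e i) w)" for w
      unfolding u by (simp add: blinfun.sum_left blinfun.sum_right blinfun.scaleR_left blinfun.scaleR_right)
    have right: "DDF z w (u, 0) = (\<Sum>j\<in>UNIV. u $ j * DDF z w (e j))" for w
      unfolding u by (simp add: blinfun.sum_right blinfun.scaleR_right)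
    show ?thesis
      unfolding e_def [symmetric] by (subst left) (simp add: right sum_distrib_left mult_ac)
  qed
  have "M_laplacian M (\<lambda>y. F (y, q)) x
      = (\<Sum>i\<in>UNIV. \<Sum>j\<in>UNIV. \<Sum>l<m. r l $ i * r l $ j * DDF (x, q) (axis i 1, 0) (axis j 1, 0))"
    by (simp add: M_laplacian_def 1 2 r sum_distrib_right)
  also have "\<dots> = (\<Sum>i\<in>UNIV. \<Sum>l<m. \<Sum>j\<in>UNIV. r l $ i * r l $ j * DDF (x, q) (axis i 1, 0) (axis j 1, 0))"
    by (intro sum.cong refl sum.swap)
  also have "\<dots> = (\<Sum>l<m. DDF (x, q) (r l, 0) (r l, 0))"
    by (subst sum.swap) (simp add: 3)
  finally show ?thesis .
qed

section \<open>Cramer-Rao inequality for finite differences\<close>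

text \<open>Supplies the test function of the Cramer-Rao argument: the linear form
  \<open>w . q\<close> centered at its mean \<open>c\<close>, whose variance is the quadratic form
  of the covariance matrix.\<close>

lemma centered_moments:
  fixes \<psi> :: "real^'n \<Rightarrow> complex" and w :: "real^'n"
  assumes p: "integrable lborel (\<lambda>q. (cmod (\<psi> q))\<^sup>2)" "(LINT q|lborel. (cmod (\<psi> q))\<^sup>2) = 1"
    and m1: "\<And>i. integrable lborel (\<lambda>q. q $ i * (cmod (\<psi> q))\<^sup>2)"
    and m2: "\<And>i j. integrable lborel (\<lambda>q. q $ i * q $ j * (cmod (\<psi> q))\<^sup>2)"
  defines "c \<equiv> (\<Sum>i\<in>UNIV. w $ i * (LINT q|lborel. q $ i * (cmod (\<psi> q))\<^sup>2))"
  shows "integrable lborel (\<lambda>q. (w \<bullet> q - c) * (cmod (\<psi> q))\<^sup>2)"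
    and "(LINT q|lborel. (w \<bullet> q - c) * (cmod (\<psi> q))\<^sup>2) = 0"
    and "integrable lborel (\<lambda>q. (w \<bullet> q - c)\<^sup>2 * (cmod (\<psi> q))\<^sup>2)"
    and "(LINT q|lborel. (w \<bullet> q - c)\<^sup>2 * (cmod (\<psi> q))\<^sup>2) = w \<bullet> (pos_cov \<psi> *v w)"
proof -
  let ?p = "\<lambda>q. (cmod (\<psi> q))\<^sup>2"
  have e1: "(w \<bullet> q) * ?p q = (\<Sum>i\<in>UNIV. w $ i * (q $ i * ?p q))" for q
    by (simp add: inner_vec_def sum_distrib_left mult_ac)
  have i1: "integrable lborel (\<lambda>q. (w \<bullet> q) * ?p q)"
    unfolding e1 by (intro Bochner_Integration.integrable_sum Bochner_Integration.integrable_mult_right m1)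
  have I1: "(LINT q|lborel. (w \<bullet> q) * ?p q) = c"
    unfolding e1 c_def using m1 by (subst Bochner_Integration.integral_sum) auto
  have e2: "(w \<bullet> q)\<^sup>2 * ?p q = (\<Sum>i\<in>UNIV. \<Sum>j\<in>UNIV. w $ i * w $ j * (q $ i * q $ j * ?p q))" for q
    by (simp add: inner_vec_def power2_eq_square sum_product sum_distrib_left mult_ac)
  have i2: "integrable lborel (\<lambda>q. (w \<bullet> q)\<^sup>2 * ?p q)"
    unfolding e2 by (intro Bochner_Integration.integrable_sum Bochner_Integration.integrable_mult_right m2)
  have I2: "(LINT q|lborel. (w \<bullet> q)\<^sup>2 * ?p q)
      = (\<Sum>i\<in>UNIV. \<Sum>j\<in>UNIV. w $ i * w $ j * (LINT q|lborel. q $ i * q $ j * ?p q))"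
    unfolding e2 using m2 by simp
  have f1: "(w \<bullet> q - c) * ?p q = (w \<bullet> q) * ?p q - c * ?p q" for q
    by (simp add: algebra_simps)
  show "integrable lborel (\<lambda>q. (w \<bullet> q - c) * ?p q)"
    unfolding f1 using i1 p by simp
  show "(LINT q|lborel. (w \<bullet> q - c) * ?p q) = 0"
    unfolding f1 using i1 p I1 by simp
  have f2: "(w \<bullet> q - c)\<^sup>2 * ?p q = (w \<bullet> q)\<^sup>2 * ?p q - 2 * c * ((w \<bullet> q) * ?p q) + c\<^sup>2 * ?p q" for q
    by (simp add: algebra_simps power2_eq_square)
  show "integrable lborel (\<lambda>q. (w \<bullet> q - c)\<^sup>2 * ?p q)"
    unfolding f2 using i1 i2 p by simp
  have "(LINT q|lborel. (w \<bullet> q - c)\<^sup>2 * ?p q) = (LINT q|lborel. (w \<bullet> q)\<^sup>2 * ?p q) - c\<^sup>2"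
    unfolding f2 using i1 i2 p I1 by (simp add: power2_eq_square)
  also have "\<dots> = w \<bullet> (pos_cov \<psi> *v w)"
  proof -
    define E where "E i = (LINT q|lborel. q $ i * ?p q)" for i
    define EE where "EE i j = (LINT q|lborel. q $ i * q $ j * ?p q)" for i j
    have cov: "pos_cov \<psi> $ i $ j = EE i j - E i * E j" for i j
      by (simp add: pos_cov_def E_def EE_def)
    have c2: "c\<^sup>2 = (\<Sum>i\<in>UNIV. \<Sum>j\<in>UNIV. (w $ i * E i) * (w $ j * E j))"
      unfolding c_def E_def [symmetric] by (simp only: power2_eq_square sum_product)
    show ?thesis
      unfolding I2 c2 EE_def [symmetric]
      by (simp add: cov inner_vec_def matrix_vector_mult_def sum_distrib_left
          algebra_simps flip: sum_subtractf)
  qed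
  finally show "(LINT q|lborel. (w \<bullet> q - c)\<^sup>2 * ?p q) = w \<bullet> (pos_cov \<psi> *v w)" .
qed

lemma integrable_cutoff_difference_square:
  fixes \<Omega> :: "'a::euclidean_space \<Rightarrow> real"
  assumes [measurable]: "\<Omega> \<in> borel_measurable borel" and p: "integrable lborel (\<lambda>q. (\<Omega> q)\<^sup>2)"
  shows "integrable lborel (\<lambda>q. cutoff R q * (\<Omega> (q + h) - \<Omega> q)\<^sup>2)"
proof (rule Bochner_Integration.integrable_bound)
  show "integrable lborel (\<lambda>q. 2 * (\<Omega> (q + h))\<^sup>2 + 2 * (\<Omega> q)\<^sup>2)"
    using lborel_integrable_translation[OF p, of h] p by simp
  show "AE q in lborel. norm (cutoff R q * (\<Omega> (q + h) - \<Omega> q)\<^sup>2)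
      \<le> norm (2 * (\<Omega> (q + h))\<^sup>2 + 2 * (\<Omega> q)\<^sup>2)"
  proof (rule AE_I2)
    fix q
    have "norm (cutoff R q * (\<Omega> (q + h) - \<Omega> q)\<^sup>2) \<le> (\<Omega> (q + h) - \<Omega> q)\<^sup>2"
      by (simp add: abs_mult cutoff_nonneg cutoff_le_1 mult_left_le_one_le)
    also have "\<dots> \<le> 2 * (\<Omega> (q + h))\<^sup>2 + 2 * (\<Omega> q)\<^sup>2"
      using zero_le_power2[of "\<Omega> (q + h) + \<Omega> q"] by (simp add: power2_eq_square algebra_simps)
    finally show "norm (cutoff R q * (\<Omega> (q + h) - \<Omega> q)\<^sup>2) \<le> norm (2 * (\<Omega> (q + h))\<^sup>2 + 2 * (\<Omega> q)\<^sup>2)"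
      by simp
  qed
qed measurable

text \<open>Integrating
  \<open>(\<Omega>(q+h) - \<Omega>(q) - s u(q) (\<Omega>(q+h) + \<Omega>(q)))\<^sup>2 \<ge> 0\<close> and translating replaces the
  integration by parts, so no derivative of \<open>\<Omega>\<close> is needed.\<close>

lemma finite_difference_cramer_rao:
  fixes \<Omega> u :: "'a::euclidean_space \<Rightarrow> real" and w h :: 'a
  assumes meas: "\<Omega> \<in> borel_measurable borel"
    and u: "\<And>q. u q = w \<bullet> q - c"
    and p: "integrable lborel (\<lambda>q. (\<Omega> q)\<^sup>2)" "(LINT q|lborel. (\<Omega> q)\<^sup>2) = 1"
    and up: "integrable lborel (\<lambda>q. u q * (\<Omega> q)\<^sup>2)" "(LINT q|lborel. u q * (\<Omega> q)\<^sup>2) = 0"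
    and uup: "integrable lborel (\<lambda>q. (u q)\<^sup>2 * (\<Omega> q)\<^sup>2)"
    and R: "R > 0"
  shows "2 * s * (- (w \<bullet> h) * (LINT q|lborel. cutoff R q * (\<Omega> q)\<^sup>2))
      - 2 * \<bar>s\<bar> * (4 / R * norm h * ((LINT q|lborel. \<bar>u q\<bar> * (\<Omega> q)\<^sup>2) + \<bar>w \<bullet> h\<bar>))
      - 2 * s\<^sup>2 * (2 * (LINT q|lborel. (u q)\<^sup>2 * (\<Omega> q)\<^sup>2) + (w \<bullet> h)\<^sup>2)
    \<le> (LINT q|lborel. cutoff R q * (\<Omega> (q + h) - \<Omega> q)\<^sup>2)"
proof -
  let ?X = "cutoff R :: 'a \<Rightarrow> real"
  let ?p = "\<lambda>q. (\<Omega> q)\<^sup>2"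
  let ?v = "LINT q|lborel. (u q)\<^sup>2 * ?p q"
  have [measurable]: "u \<in> borel_measurable borel" "\<Omega> \<in> borel_measurable borel"
    unfolding u using meas by measurable
  have cutint: "integrable lborel (\<lambda>q. ?X (q + a) * g q)" if "integrable lborel g" for g a
    using that
    by (rule Bochner_Integration.integrable_bound)
      (use that in \<open>auto simp: abs_mult cutoff_nonneg intro!: mult_left_le_one_le cutoff_le_1\<close>)
  have cutint0: "integrable lborel (\<lambda>q. ?X q * g q)" if "integrable lborel g" for g
    using cutint[OF that, of 0] by simp
  have au: "integrable lborel (\<lambda>q. \<bar>u q\<bar> * ?p q)"
    using integrable_abs[OF up(1)] by (simp add: abs_mult)
  have ip: "integrable lborel (\<lambda>q. (u q - w \<bullet> h) * ?p q)"
    using up p by (simp add: left_diff_distrib)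
  have ip2: "integrable lborel (\<lambda>q. (u q - w \<bullet> h)\<^sup>2 * ?p q)"
      "(LINT q|lborel. (u q - w \<bullet> h)\<^sup>2 * ?p q) = ?v + (w \<bullet> h)\<^sup>2"
  proof -
    have e: "(u q - w \<bullet> h)\<^sup>2 * ?p q
      = (u q)\<^sup>2 * ?p q - 2 * (w \<bullet> h) * (u q * ?p q) + (w \<bullet> h)\<^sup>2 * ?p q" for q
      by (simp add: power2_eq_square algebra_simps)
    show "integrable lborel (\<lambda>q. (u q - w \<bullet> h)\<^sup>2 * ?p q)"
      "(LINT q|lborel. (u q - w \<bullet> h)\<^sup>2 * ?p q) = ?v + (w \<bullet> h)\<^sup>2"
      unfolding e using up p uup by simp_all
  qed
  \<comment> \<open>Substituting \<open>q - h\<close> for \<open>q\<close> moves the shift onto the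
    cutoff and turns \<open>u\<close> into \<open>u - w . h\<close>. The constant
    \<open>w . h\<close> is what the derivative of \<open>u\<close> would yield in an integration by
    parts.\<close>
  have T1: "integrable lborel (\<lambda>q. ?X q * (u q * ?p (q + h)))"
      "(LINT q|lborel. ?X q * (u q * ?p (q + h))) = (LINT q|lborel. ?X (q - h) * ((u q - w \<bullet> h) * ?p q))"
    using lborel_integrable_translation[OF cutint[OF ip, of "- h"], of h]
      lborel_integral_translation[OF cutint[OF ip, of "- h"], of h]
    by (simp_all add: u inner_add_right)
  have T2: "integrable lborel (\<lambda>q. (u q)\<^sup>2 * ?p (q + h))"
      "(LINT q|lborel. (u q)\<^sup>2 * ?p (q + h)) = ?v + (w \<bullet> h)\<^sup>2"
    using lborel_integrable_translation[OF ip2(1), of h]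
      lborel_integral_translation[OF ip2(1), of h] ip2(2)
    by (simp_all add: u inner_add_right)
  \<comment> \<open>The error caused by shifting the cutoff; the Lipschitz bound makes it of order
    \<open>norm h / R\<close>.\<close>
  define I where "I = (LINT q|lborel. (?X (q - h) - ?X q) * ((u q - w \<bullet> h) * ?p q))"
  have Ib: "\<bar>I\<bar> \<le> 4 / R * norm h * ((LINT q|lborel. \<bar>u q\<bar> * ?p q) + \<bar>w \<bullet> h\<bar>)"
  proof -
    have "norm I \<le> (LINT q|lborel. 4 / R * norm h * (\<bar>u q\<bar> * ?p q + \<bar>w \<bullet> h\<bar> * ?p q))"
      unfolding I_def
    proof (rule Bochner_Integration.integral_norm_bound_integral)
      show "integrable lborel (\<lambda>q. (?X (q - h) - ?X q) * ((u q - w \<bullet> h) * ?p q))"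
        using cutint[OF ip, of "- h"] cutint0[OF ip] by (simp add: left_diff_distrib)
      show "integrable lborel (\<lambda>q. 4 / R * norm h * (\<bar>u q\<bar> * ?p q + \<bar>w \<bullet> h\<bar> * ?p q))"
        using au p by simp
      fix q
      have "norm ((?X (q - h) - ?X q) * ((u q - w \<bullet> h) * ?p q))
          = \<bar>?X (q - h) - ?X q\<bar> * (\<bar>u q - w \<bullet> h\<bar> * ?p q)"
        by (simp add: abs_mult)
      also have "\<dots> \<le> (4 / R * norm h) * ((\<bar>u q\<bar> + \<bar>w \<bullet> h\<bar>) * ?p q)"
        using cutoff_lipschitz[OF R, of "q - h" q] R
        by (intro mult_mono mult_right_mono abs_triangle_ineq4) auto
      finally show "norm ((?X (q - h) - ?X q) * ((u q - w \<bullet> h) * ?p q))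
          \<le> 4 / R * norm h * (\<bar>u q\<bar> * ?p q + \<bar>w \<bullet> h\<bar> * ?p q)"
        by (simp add: algebra_simps)
    qed
    also have "\<dots> = 4 / R * norm h * ((LINT q|lborel. \<bar>u q\<bar> * ?p q) + \<bar>w \<bullet> h\<bar>)"
      using au p by simp
    finally show ?thesis by simp
  qed
  have diff: "(LINT q|lborel. ?X q * (u q * ?p (q + h))) - (LINT q|lborel. ?X q * (u q * ?p q))
      = I - (w \<bullet> h) * (LINT q|lborel. ?X q * ?p q)"
  proof -
    have "(LINT q|lborel. ?X (q - h) * ((u q - w \<bullet> h) * ?p q)) - (LINT q|lborel. ?X q * (u q * ?p q))
        = (LINT q|lborel. ?X (q - h) * ((u q - w \<bullet> h) * ?p q) - ?X q * (u q * ?p q))"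
      using cutint[OF ip, of "- h"] cutint0[OF up(1)] by simp
    also have "\<dots> = (LINT q|lborel. (?X (q - h) - ?X q) * ((u q - w \<bullet> h) * ?p q) - (w \<bullet> h) * (?X q * ?p q))"
      by (intro Bochner_Integration.integral_cong refl) (simp add: algebra_simps)
    also have "\<dots> = I - (w \<bullet> h) * (LINT q|lborel. ?X q * ?p q)"
      unfolding I_def
      using cutint[OF ip, of "- h"] cutint0[OF ip] cutint0[OF p(1)]
      by (subst Bochner_Integration.integral_diff) (auto simp: left_diff_distrib)
    finally show ?thesis unfolding T1(2) .
  qed
  \<comment> \<open>Expanding the square produces \<open>(s u)^2 (?a + ?b)^2\<close>; adding
    \<open>(s u)^2 (?a - ?b)^2\<close> completes it to \<open>2 (s u)^2 (?a^2 + ?b^2)\<close>, which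
    has no mixed product. The cutoff is then estimated by 1 in this term alone.\<close>
  have pt: "2 * s * (?X q * (u q * ?p (q + h)) - ?X q * (u q * ?p q))
      - 2 * s\<^sup>2 * ((u q)\<^sup>2 * ?p (q + h) + (u q)\<^sup>2 * ?p q) \<le> ?X q * (\<Omega> (q + h) - \<Omega> q)\<^sup>2" for q
  proof -
    let ?a = "\<Omega> (q + h)" and ?b = "\<Omega> q"
    have *: "2 * s * u q * (?a\<^sup>2 - ?b\<^sup>2) - 2 * (s * u q)\<^sup>2 * (?a\<^sup>2 + ?b\<^sup>2) \<le> (?a - ?b)\<^sup>2"
    proof -
      have "(?a - ?b)\<^sup>2 - 2 * s * u q * (?a\<^sup>2 - ?b\<^sup>2) + 2 * (s * u q)\<^sup>2 * (?a\<^sup>2 + ?b\<^sup>2)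
          = (?a - ?b - s * u q * (?a + ?b))\<^sup>2 + (s * u q)\<^sup>2 * (?a - ?b)\<^sup>2"
        by (simp add: power2_eq_square algebra_simps)
      also have "\<dots> \<ge> 0" by simp
      finally show ?thesis by linarith
    qed
    have "?X q * (2 * s * u q * (?a\<^sup>2 - ?b\<^sup>2)) - 2 * (s * u q)\<^sup>2 * (?a\<^sup>2 + ?b\<^sup>2)
        \<le> ?X q * (2 * s * u q * (?a\<^sup>2 - ?b\<^sup>2)) - ?X q * (2 * (s * u q)\<^sup>2 * (?a\<^sup>2 + ?b\<^sup>2))"
      by (intro diff_left_mono mult_left_le_one_le) (auto simp: cutoff_nonneg cutoff_le_1)
    also have "\<dots> \<le> ?X q * (?a - ?b)\<^sup>2"
      using mult_left_mono[OF * cutoff_nonneg] by (simp add: right_diff_distrib)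
    finally show ?thesis by (simp add: power_mult_distrib algebra_simps)
  qed
  have iR: "integrable lborel (\<lambda>q. ?X q * (\<Omega> (q + h) - \<Omega> q)\<^sup>2)"
    by (rule integrable_cutoff_difference_square[OF meas p(1)])
  have "(LINT q|lborel. 2 * s * (?X q * (u q * ?p (q + h)) - ?X q * (u q * ?p q))
      - 2 * s\<^sup>2 * ((u q)\<^sup>2 * ?p (q + h) + (u q)\<^sup>2 * ?p q))
      \<le> (LINT q|lborel. ?X q * (\<Omega> (q + h) - \<Omega> q)\<^sup>2)"
    using T1(1) T2(1) uup cutint0[OF up(1)] iR pt by (intro integral_mono) auto
  also have "(LINT q|lborel. 2 * s * (?X q * (u q * ?p (q + h)) - ?X q * (u q * ?p q))
      - 2 * s\<^sup>2 * ((u q)\<^sup>2 * ?p (q + h) + (u q)\<^sup>2 * ?p q))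
      = 2 * s * (I - (w \<bullet> h) * (LINT q|lborel. ?X q * ?p q)) - 2 * s\<^sup>2 * (2 * ?v + (w \<bullet> h)\<^sup>2)"
    using T1(1) T2 uup cutint0[OF up(1)] diff by simp
  finally have "2 * s * (I - (w \<bullet> h) * (LINT q|lborel. ?X q * ?p q)) - 2 * s\<^sup>2 * (2 * ?v + (w \<bullet> h)\<^sup>2)
      \<le> (LINT q|lborel. ?X q * (\<Omega> (q + h) - \<Omega> q)\<^sup>2)" .
  moreover have "- (2 * \<bar>s\<bar> * (4 / R * norm h * ((LINT q|lborel. \<bar>u q\<bar> * ?p q) + \<bar>w \<bullet> h\<bar>))) \<le> 2 * s * I"
  proof -
    have "\<bar>2 * s * I\<bar> = 2 * \<bar>s\<bar> * \<bar>I\<bar>" by (simp add: abs_mult)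
    also have "\<dots> \<le> 2 * \<bar>s\<bar> * (4 / R * norm h * ((LINT q|lborel. \<bar>u q\<bar> * ?p q) + \<bar>w \<bullet> h\<bar>))"
      by (intro mult_left_mono Ib) auto
    finally show ?thesis by linarith
  qed
  ultimately show ?thesis by (simp add: right_diff_distrib)
qed

section \<open>The quantum potential of a mixed state\<close>

text \<open>Rotating by a phase makes \<open>|\<rho> x y|\<close> the real part of an expression
  linear in the kernel, so the series can be expanded term by term. The reverse triangle inequality
  then removes the phases, and nonnegative terms allow truncation to \<open>K\<close>.\<close>

lemma density_kernel_deficit:
  fixes \<psi> :: "nat \<Rightarrow> 'a \<Rightarrow> complex"
  assumes nonneg: "\<And>k. \<omega> k \<ge> 0"
    and kernel: "\<And>x y. (\<lambda>k. complex_of_real (\<omega> k) * \<psi> k x * cnj (\<psi> k y)) sums \<rho> x y"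
    and K: "finite K"
  shows "(\<Sum>k\<in>K. \<omega> k * (cmod (\<psi> k x) - cmod (\<psi> k y))\<^sup>2)
    \<le> cmod (\<rho> x x) + cmod (\<rho> y y) - 2 * cmod (\<rho> x y)"
proof -
  \<comment> \<open>The separate value 1 keeps \<open>cmod c = 1\<close> when the kernel vanishes,
    since \<open>sgn 0 = 0\<close>.\<close>
  define c where "c = (if \<rho> x y = 0 then 1 else sgn (\<rho> x y))"
  have c1: "cmod c = 1" by (simp add: c_def norm_sgn)
  have c2: "Re (cnj c * \<rho> x y) = cmod (\<rho> x y)"
  proof (cases "\<rho> x y = 0")
    case False
    then have "cnj c * \<rho> x y = cnj (\<rho> x y) * \<rho> x y / cmod (\<rho> x y)"
      by (simp add: c_def sgn_div_norm scaleR_conv_of_real divide_inverse mult_ac)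
    also have "\<dots> = complex_of_real (cmod (\<rho> x y))"
      using False by (simp add: mult.commute[of "cnj _"] complex_norm_square [symmetric] power2_eq_square)
    finally show ?thesis by simp
  qed simp
  have expand: "(cmod (a - z))\<^sup>2 = Re (a * cnj a) + Re (z * cnj z) - 2 * Re (a * cnj z)" for a z
    unfolding cmod_power2 by (simp add: power2_eq_square algebra_simps)
  have "(\<lambda>k. Re (complex_of_real (\<omega> k) * \<psi> k x * cnj (\<psi> k x))
        + Re (complex_of_real (\<omega> k) * \<psi> k y * cnj (\<psi> k y))
        - 2 * Re (cnj c * (complex_of_real (\<omega> k) * \<psi> k x * cnj (\<psi> k y))))
      sums (Re (\<rho> x x) + Re (\<rho> y y) - 2 * Re (cnj c * \<rho> x y))"
    by (intro sums_add sums_diff sums_mult sums_Re kernel)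
  moreover have "Re (complex_of_real (\<omega> k) * \<psi> k x * cnj (\<psi> k x))
        + Re (complex_of_real (\<omega> k) * \<psi> k y * cnj (\<psi> k y))
        - 2 * Re (cnj c * (complex_of_real (\<omega> k) * \<psi> k x * cnj (\<psi> k y)))
      = \<omega> k * (cmod (\<psi> k x - c * \<psi> k y))\<^sup>2" for k
  proof -
    have "(c * \<psi> k y) * cnj (c * \<psi> k y) = \<psi> k y * cnj (\<psi> k y)"
      using c1 by (simp only: complex_norm_square [symmetric] norm_mult) simp
    then have "\<omega> k * (cmod (\<psi> k x - c * \<psi> k y))\<^sup>2
        = \<omega> k * (Re (\<psi> k x * cnj (\<psi> k x)) + Re (\<psi> k y * cnj (\<psi> k y)) - 2 * Re (\<psi> k x * cnj (c * \<psi> k y)))"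
      by (simp only: expand)
    also have "\<dots> = Re (complex_of_real (\<omega> k) * (\<psi> k x * cnj (\<psi> k x)))
        + Re (complex_of_real (\<omega> k) * (\<psi> k y * cnj (\<psi> k y)))
        - 2 * Re (complex_of_real (\<omega> k) * (\<psi> k x * cnj (c * \<psi> k y)))"
      by (simp add: algebra_simps)
    finally show ?thesis by (simp only: mult_ac complex_cnj_mult)
  qed
  ultimately have s: "(\<lambda>k. \<omega> k * (cmod (\<psi> k x - c * \<psi> k y))\<^sup>2)
      sums (Re (\<rho> x x) + Re (\<rho> y y) - 2 * cmod (\<rho> x y))"
    by (simp only: c2)
  have "(\<Sum>k\<in>K. \<omega> k * (cmod (\<psi> k x) - cmod (\<psi> k y))\<^sup>2)
      \<le> (\<Sum>k\<in>K. \<omega> k * (cmod (\<psi> k x - c * \<psi> k y))\<^sup>2)"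
  proof (intro sum_mono mult_left_mono nonneg)
    fix k
    have "\<bar>cmod (\<psi> k x) - cmod (\<psi> k y)\<bar> \<le> cmod (\<psi> k x - c * \<psi> k y)"
      using norm_triangle_ineq3[of "\<psi> k x" "c * \<psi> k y"] c1 by (simp add: norm_mult)
    then show "(cmod (\<psi> k x) - cmod (\<psi> k y))\<^sup>2 \<le> (cmod (\<psi> k x - c * \<psi> k y))\<^sup>2"
      by (metis abs_ge_zero power2_abs power_mono)
  qed
  also have "\<dots> \<le> Re (\<rho> x x) + Re (\<rho> y y) - 2 * cmod (\<rho> x y)"
    using sum_le_suminf[OF sums_summable[OF s] K] nonneg sums_unique[OF s] by simp
  also have "\<dots> \<le> cmod (\<rho> x x) + cmod (\<rho> y y) - 2 * cmod (\<rho> x y)"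
    by (intro diff_right_mono add_mono complex_Re_le_cmod)
  finally show ?thesis .
qed

section \<open>Integration against the cutoff and the limit of vanishing step\<close>

text \<open>Translation invariance moves the second difference from \<open>f\<close>, which is
  merely integrable, onto the cutoff. In the application \<open>f\<close> is the diagonal
  density.\<close>

lemma cutoff_integral_second_difference_le:
  fixes f :: "'a::euclidean_space \<Rightarrow> real"
  assumes f: "integrable lborel f" "\<And>q. 0 \<le> f q" and R: "R > 0" and h: "norm h \<le> R"
  shows "integrable lborel (\<lambda>q. cutoff R q * (f (q + h) + f (q - h) - 2 * f q))"
    and "(LINT q|lborel. cutoff R q * (f (q + h) + f (q - h) - 2 * f q))
      \<le> 34 * (norm h / R)\<^sup>2 * (LINT q|lborel. f q)"
proof -
  let ?X = "cutoff R :: 'a \<Rightarrow> real"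
  have ci: "integrable lborel (\<lambda>q. ?X (q + a) * f q)" for a
    using f(1) by (rule Bochner_Integration.integrable_bound)
      (use f in \<open>auto simp: abs_mult cutoff_nonneg intro!: mult_left_le_one_le cutoff_le_1\<close>)
  have ci0: "integrable lborel (\<lambda>q. ?X q * f q)" using ci[of 0] by simp
  have t: "integrable lborel (\<lambda>q. ?X q * f (q + a))"
      "(LINT q|lborel. ?X q * f (q + a)) = (LINT q|lborel. ?X (q - a) * f q)" for a
    using lborel_integrable_translation[OF ci[of "- a"], of a]
      lborel_integral_translation[OF ci[of "- a"], of a] by simp_all
  have e: "?X q * (f (q + h) + f (q - h) - 2 * f q)
      = ?X q * f (q + h) + ?X q * f (q + (- h)) - 2 * (?X q * f q)" for q
    by (simp add: algebra_simps)
  show "integrable lborel (\<lambda>q. ?X q * (f (q + h) + f (q - h) - 2 * f q))"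
    unfolding e using t(1)[of h] t(1)[of "- h"] ci0 by simp
  have "(LINT q|lborel. ?X q * (f (q + h) + f (q - h) - 2 * f q))
      = (LINT q|lborel. ?X (q - h) * f q) + (LINT q|lborel. ?X (q + h) * f q)
        - 2 * (LINT q|lborel. ?X q * f q)"
    unfolding e using t(1)[of h] t(1)[of "- h"] ci0 t(2)[of h] t(2)[of "- h"] by simp
  also have "\<dots> = (LINT q|lborel. (?X (q + h) + ?X (q - h) - 2 * ?X q) * f q)"
    using ci[of h] ci[of "- h"] ci0 by (simp add: left_diff_distrib distrib_right mult.assoc)
  also have "\<dots> \<le> (LINT q|lborel. 34 * (norm h / R)\<^sup>2 * f q)"
  proof (rule integral_mono)
    show "integrable lborel (\<lambda>q. (?X (q + h) + ?X (q - h) - 2 * ?X q) * f q)"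
      using ci[of h] ci[of "- h"] ci0 by (simp add: left_diff_distrib distrib_right mult.assoc)
    show "integrable lborel (\<lambda>q. 34 * (norm h / R)\<^sup>2 * f q)" using f by simp
    show "(?X (q + h) + ?X (q - h) - 2 * ?X q) * f q \<le> 34 * (norm h / R)\<^sup>2 * f q" for q
      using f by (intro mult_right_mono cutoff_second_difference[OF R h]) auto
  qed
  finally show "(LINT q|lborel. ?X q * (f (q + h) + f (q - h) - 2 * f q))
      \<le> 34 * (norm h / R)\<^sup>2 * (LINT q|lborel. f q)" by simp
qed

text \<open>Dominated convergence: each quotient is a mean of second derivatives at intermediate
  points, and the compact support of the cutoff provides a uniform bound.\<close>

lemma cutoff_integral_second_difference_quotient:
  fixes F :: "'b::real_normed_vector \<Rightarrow> real" and g :: "'a::euclidean_space \<Rightarrow> 'b"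
    and v :: 'b
  assumes D: "\<And>z. (F has_derivative blinfun_apply (DF z)) (at z)"
    and DD: "\<And>z. (DF has_derivative blinfun_apply (DDF z)) (at z)"
    and cont: "continuous_on UNIV DDF" and g: "continuous_on UNIV g" and R: "R > 0"
    and T: "\<And>n. 0 < T n" "\<And>n. T n \<le> 1" "T \<longlonglongrightarrow> 0"
  defines "S \<equiv> \<lambda>n q. cutoff R q * ((F (g q + T n *\<^sub>R v) + F (g q - T n *\<^sub>R v) - 2 * F (g q)) / (T n)\<^sup>2)"
  shows "integrable lborel (S n)"
    and "integrable lborel (\<lambda>q. cutoff R q * DDF (g q) v v)"
    and "(\<lambda>n. LINT q|lborel. S n q) \<longlonglongrightarrow> (LINT q|lborel. cutoff R q * DDF (g q) v v)"
proof -
  have contDDv: "continuous_on A (\<lambda>x. DDF (k x) v v)" if "continuous_on A k" for A and k :: "'c::topological_space \<Rightarrow> 'b"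
    using continuous_on_compose2[OF cont that] by (intro continuous_intros) auto
  have contF: "continuous_on UNIV F"
    using D by (meson continuous_at_imp_continuous_on has_derivative_continuous)
  have contFk: "continuous_on A (\<lambda>x. F (k x))" if "continuous_on A k" for A and k :: "'a \<Rightarrow> 'b"
    using continuous_on_compose2[OF contF that] by auto
  define G where "G = (\<lambda>(q, s). g q + s *\<^sub>R v)"
  have contG: "continuous_on A G" for A
    unfolding G_def split_beta
    by (intro continuous_intros continuous_on_compose2[OF g]) auto
  \<comment> \<open>Steps are at most 1, so all intermediate points over the support of the cutoff
    lie in the image of this compact set under \<open>G\<close>.\<close>
  have "compact ((\<lambda>x. DDF (G x) v v) ` (cball 0 R \<times> {-1..1}))"
    by (intro compact_continuous_image contDDv contG compact_Times compact_cball compact_Icc)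
  then obtain B where B: "\<And>x. x \<in> cball 0 R \<times> {-1..1} \<Longrightarrow> norm (DDF (G x) v v) \<le> B"
    using compact_imp_bounded bounded_iff by (metis (no_types, lifting) imageI)
  have "\<exists>\<xi>. 0 < \<xi> \<and> \<xi> < T n \<and> (F (g q + T n *\<^sub>R v) + F (g q - T n *\<^sub>R v) - 2 * F (g q)) / (T n)\<^sup>2
      = (DDF (g q + \<xi> *\<^sub>R v) v v + DDF (g q - \<xi> *\<^sub>R v) v v) / 2" for n q
    using second_difference_eq[OF D DD T(1)[of n], of "g q" v] T(1)[of n]
    by (metis (no_types, lifting) nonzero_mult_div_cancel_left power_not_zero less_irrefl)
  then obtain \<xi> where \<xi>: "\<And>n q. 0 < \<xi> n q" "\<And>n q. \<xi> n q < T n"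
    and eq: "\<And>n q. (F (g q + T n *\<^sub>R v) + F (g q - T n *\<^sub>R v) - 2 * F (g q)) / (T n)\<^sup>2
      = (DDF (g q + \<xi> n q *\<^sub>R v) v v + DDF (g q - \<xi> n q *\<^sub>R v) v v) / 2"
    by metis
  have lim: "AE q in lborel. (\<lambda>n. S n q) \<longlonglongrightarrow> cutoff R q * DDF (g q) v v"
  proof (rule AE_I2)
    fix q
    have x0: "(\<lambda>n. \<xi> n q) \<longlonglongrightarrow> 0"
      by (rule tendsto_sandwich[OF _ _ tendsto_const T(3)]) (auto intro!: always_eventually less_imp_le \<xi>)
    have c: "isCont (\<lambda>s. DDF (g q + s *\<^sub>R v) v v) 0" "isCont (\<lambda>s. DDF (g q - s *\<^sub>R v) v v) 0"
      using contDDv[of UNIV "\<lambda>s::real. g q + s *\<^sub>R v"] contDDv[of UNIV "\<lambda>s::real. g q - s *\<^sub>R v"]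
      by (auto simp: continuous_on_eq_continuous_at intro!: continuous_intros)
    have "(\<lambda>n. cutoff R q * ((DDF (g q + \<xi> n q *\<^sub>R v) v v + DDF (g q - \<xi> n q *\<^sub>R v) v v) / 2))
        \<longlonglongrightarrow> cutoff R q * ((DDF (g q + 0 *\<^sub>R v) v v + DDF (g q - 0 *\<^sub>R v) v v) / 2)"
      by (intro tendsto_intros isCont_tendsto_compose[OF c(1) x0] isCont_tendsto_compose[OF c(2) x0]) simp
    then show "(\<lambda>n. S n q) \<longlonglongrightarrow> cutoff R q * DDF (g q) v v"
      by (simp add: S_def eq)
  qed
  have bound: "AE q in lborel. norm (S n q) \<le> indicator (cball 0 R) q * B" for n
  proof (rule AE_I2)
    fix q :: 'a
    show "norm (S n q) \<le> indicator (cball 0 R) q * B"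
    proof (cases "norm q \<le> R")
      case True
      have "\<xi> n q \<le> 1" "0 \<le> \<xi> n q" using \<xi>[of n q] T(2)[of n] by auto
      then have "norm (DDF (g q + \<xi> n q *\<^sub>R v) v v) \<le> B" "norm (DDF (g q - \<xi> n q *\<^sub>R v) v v) \<le> B"
        using B[of "(q, \<xi> n q)"] B[of "(q, - \<xi> n q)"] True by (auto simp: G_def)
      then have b: "norm ((DDF (g q + \<xi> n q *\<^sub>R v) v v + DDF (g q - \<xi> n q *\<^sub>R v) v v) / 2) \<le> B"
        by simp
      have "norm (S n q) = cutoff R q * norm ((DDF (g q + \<xi> n q *\<^sub>R v) v v + DDF (g q - \<xi> n q *\<^sub>R v) v v) / 2)"
        unfolding S_def eq norm_mult by (simp add: cutoff_nonneg)
      also have "\<dots> \<le> 1 * B"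
        using b by (intro mult_mono cutoff_le_1) (auto simp: cutoff_nonneg)
      finally show ?thesis using True by simp
    next
      case False
      then show ?thesis using R by (simp add: S_def cutoff_eq_0)
    qed
  qed
  have dom: "integrable lborel (\<lambda>q. indicator (cball 0 R) q * B :: real)"
    by (intro integrable_mult_left integrable_real_indicator) 
      (use emeasure_lborel_cball_finite[of 0 R] in simp_all)
  \<comment> \<open>Measurability is read off from \<open>F\<close>, because the intermediate points
    \<open>\<xi> n q\<close> are merely chosen and need not depend measurably on
    \<open>q\<close>.\<close>
  have meas: "S n \<in> borel_measurable lborel" for n
    unfolding S_def measurable_lborel2 by (intro borel_measurable_continuous_onI continuous_intros contFk g)
      (use T(1)[of n] in auto)
  have meas': "(\<lambda>q. cutoff R q * DDF (g q) v v) \<in> borel_measurable lborel"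
    unfolding measurable_lborel2 by (intro borel_measurable_continuous_onI continuous_intros contDDv g)
  show "integrable lborel (S n)"
    by (rule integrable_dominated_convergence2[OF meas' meas dom lim bound])
  show "integrable lborel (\<lambda>q. cutoff R q * DDF (g q) v v)"
    by (rule integrable_dominated_convergence[OF meas' meas dom lim bound])
  show "(\<lambda>n. LINT q|lborel. S n q) \<longlonglongrightarrow> (LINT q|lborel. cutoff R q * DDF (g q) v v)"
    by (rule integral_dominated_convergence[OF meas' meas dom lim bound])
qed

text \<open>Adding the deficit inequalities at \<open>q + t r\<close> and \<open>q - t r\<close>
  controls twice the second difference of \<open>F\<close> in its first argument, hence
  \<open>17 = 34 / 2\<close>. The step tends to zero at fixed \<open>R\<close>, and the multipliers
  \<open>\<sigma> k\<close> stay free so that they can later be adapted to \<open>r\<close>.\<close>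

lemma cutoff_second_derivative_bound:
  fixes F :: "'a::euclidean_space \<times> 'a \<Rightarrow> real" and r :: 'a and \<Omega> :: "'k \<Rightarrow> 'a \<Rightarrow> real"
  assumes D: "\<And>z. (F has_derivative blinfun_apply (DF z)) (at z)"
    and DD: "\<And>z. (DF has_derivative blinfun_apply (DDF z)) (at z)"
    and cont: "continuous_on UNIV DDF"
    and f: "integrable lborel (\<lambda>q. F (q, q))" "\<And>q. 0 \<le> F (q, q)"
    and \<omega>: "\<And>k. k \<in> K \<Longrightarrow> 0 \<le> \<omega> k"
    and deficit: "\<And>x y. (\<Sum>k\<in>K. \<omega> k * (\<Omega> k x - \<Omega> k y)\<^sup>2) \<le> F (x, x) + F (y, y) - 2 * F (x, y)"
    and meas: "\<And>k. k \<in> K \<Longrightarrow> \<Omega> k \<in> borel_measurable borel"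
    and u: "\<And>k q. u k q = w k \<bullet> q - c k"
    and p: "\<And>k. k \<in> K \<Longrightarrow> integrable lborel (\<lambda>q. (\<Omega> k q)\<^sup>2)"
      "\<And>k. k \<in> K \<Longrightarrow> (LINT q|lborel. (\<Omega> k q)\<^sup>2) = 1"
    and up: "\<And>k. k \<in> K \<Longrightarrow> integrable lborel (\<lambda>q. u k q * (\<Omega> k q)\<^sup>2)"
      "\<And>k. k \<in> K \<Longrightarrow> (LINT q|lborel. u k q * (\<Omega> k q)\<^sup>2) = 0"
    and uup: "\<And>k. k \<in> K \<Longrightarrow> integrable lborel (\<lambda>q. (u k q)\<^sup>2 * (\<Omega> k q)\<^sup>2)"
    and R: "R > 0"
  shows "integrable lborel (\<lambda>q. cutoff R q * DDF (q, q) (r, 0) (r, 0))"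
    and "(LINT q|lborel. cutoff R q * DDF (q, q) (r, 0) (r, 0))
      \<le> 17 * (norm r / R)\<^sup>2 * (LINT q|lborel. F (q, q))
        - (\<Sum>k\<in>K. \<omega> k * (2 * \<sigma> k * (- (w k \<bullet> r) * (LINT q|lborel. cutoff R q * (\<Omega> k q)\<^sup>2))
            - 2 * \<bar>\<sigma> k\<bar> * (4 / R * norm r * (LINT q|lborel. \<bar>u k q\<bar> * (\<Omega> k q)\<^sup>2))
            - 4 * (\<sigma> k)\<^sup>2 * (LINT q|lborel. (u k q)\<^sup>2 * (\<Omega> k q)\<^sup>2)))"
proof -
  let ?X = "cutoff R :: 'a \<Rightarrow> real"
  \<comment> \<open>Steps stay below 1 for the dominated convergence and below
    \<open>R / (norm r + 1)\<close> so that the shift has norm at most \<open>R\<close>, as the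
    cutoff estimate demands.\<close>
  define T where "T n = min 1 (R / (norm r + 1)) / real (Suc n)" for n
  have T0: "0 < T n" for n
    using R by (simp add: T_def add_nonneg_pos)
  have Tm: "T n \<le> min 1 (R / (norm r + 1))" for n
  proof -
    have "0 \<le> min 1 (R / (norm r + 1))" using R by simp
    then show ?thesis unfolding T_def by (intro divide_le_eq[THEN iffD2]) (auto simp: mult_le_cancel_left1 simp del: min_le_iff_disj)
  qed
  have T1: "T n \<le> 1" for n using Tm[of n] by simp
  have TR: "norm (T n *\<^sub>R r) \<le> R" for n
  proof -
    have "T n * norm r \<le> R / (norm r + 1) * (norm r + 1)"
      using Tm[of n] R by (intro mult_mono) auto
    also have "\<dots> = R" using norm_ge_zero[of r] by (simp add: add_nonneg_eq_0_iff)
    finally show ?thesis using T0[of n] by simp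
  qed
  have Tl: "T \<longlonglongrightarrow> 0" unfolding T_def by (rule LIMSEQ_Suc[OF lim_const_over_n])
  have g: "continuous_on UNIV (\<lambda>q::'a. (q, q))" by (intro continuous_intros)
  define S where "S n q = ?X q * ((F (q + T n *\<^sub>R r, q) + F (q - T n *\<^sub>R r, q) - 2 * F (q, q)) / (T n)\<^sup>2)" for n q
  note Q = cutoff_integral_second_difference_quotient[OF D DD cont g R T0 T1 Tl, where v = "(r, 0)"]
  show "integrable lborel (\<lambda>q. ?X q * DDF (q, q) (r, 0) (r, 0))" by (rule Q(2))
  have Sint: "integrable lborel (S n)" for n
    using Q(1)[of n] by (simp add: S_def [abs_def])
  have Slim: "(\<lambda>n. LINT q|lborel. S n q) \<longlonglongrightarrow> (LINT q|lborel. ?X q * DDF (q, q) (r, 0) (r, 0))"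
    using Q(3) by (simp add: S_def)
  define P where "P k = (LINT q|lborel. ?X q * (\<Omega> k q)\<^sup>2)" for k
  define A where "A k = (LINT q|lborel. \<bar>u k q\<bar> * (\<Omega> k q)\<^sup>2)" for k
  define v where "v k = (LINT q|lborel. (u k q)\<^sup>2 * (\<Omega> k q)\<^sup>2)" for k
  \<comment> \<open>The finite-difference bound for the shift \<open>t r\<close> and the multiplier
    \<open>t \<sigma> k\<close>, divided by \<open>t^2\<close>. Reversing both signs leaves it
    unchanged, so it serves forward and backward differences.\<close>
  define L where "L k t = 2 * \<sigma> k * (- (w k \<bullet> r) * P k)
      - 2 * \<bar>\<sigma> k\<bar> * (4 / R * norm r * (A k + t * \<bar>w k \<bullet> r\<bar>))
      - 2 * (\<sigma> k)\<^sup>2 * (2 * v k + t\<^sup>2 * (w k \<bullet> r)\<^sup>2)" for k t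
  have CR: "t\<^sup>2 * L k t \<le> (LINT q|lborel. ?X q * (\<Omega> k (q + t *\<^sub>R r) - \<Omega> k q)\<^sup>2)"
      "t\<^sup>2 * L k t \<le> (LINT q|lborel. ?X q * (\<Omega> k (q - t *\<^sub>R r) - \<Omega> k q)\<^sup>2)"
    if k: "k \<in> K" and t: "t > 0" for k t
  proof -
    note cr = finite_difference_cramer_rao[OF meas[OF k] u p(1)[OF k] p(2)[OF k] up(1)[OF k] up(2)[OF k] uup[OF k] R]
    have *: "2 * s * (- (w k \<bullet> h) * P k) - 2 * \<bar>s\<bar> * (4 / R * norm h * (A k + \<bar>w k \<bullet> h\<bar>))
        - 2 * s\<^sup>2 * (2 * v k + (w k \<bullet> h)\<^sup>2) = t\<^sup>2 * L k t"
      if "s = t * \<sigma> k \<and> h = t *\<^sub>R r \<or> s = - (t * \<sigma> k) \<and> h = - (t *\<^sub>R r)" for s h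
      using that t
      by (auto simp: L_def abs_mult power_mult_distrib power2_eq_square right_diff_distrib distrib_left
          mult_ac add_divide_distrib)
    show "t\<^sup>2 * L k t \<le> (LINT q|lborel. ?X q * (\<Omega> k (q + t *\<^sub>R r) - \<Omega> k q)\<^sup>2)"
      using cr[of "t * \<sigma> k" "t *\<^sub>R r"] *[of "t * \<sigma> k" "t *\<^sub>R r"] by (simp add: P_def A_def v_def)
    show "t\<^sup>2 * L k t \<le> (LINT q|lborel. ?X q * (\<Omega> k (q - t *\<^sub>R r) - \<Omega> k q)\<^sup>2)"
      using cr[of "- (t * \<sigma> k)" "- (t *\<^sub>R r)"] *[of "- (t * \<sigma> k)" "- (t *\<^sub>R r)"]
      by (simp add: P_def A_def v_def)
  qed
  let ?If = "LINT q|lborel. F (q, q)"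
  have step: "(LINT q|lborel. S n q) \<le> 17 * (norm r / R)\<^sup>2 * ?If - (\<Sum>k\<in>K. \<omega> k * L k (T n))" for n
  proof -
    define t where "t = T n"
    have t: "t > 0" using T0 by (simp add: t_def)
    define h where "h = t *\<^sub>R r"
    have h: "norm h \<le> R" using TR by (simp add: h_def t_def)
    let ?f = "\<lambda>q. F (q, q)"
    let ?d = "\<lambda>k s q. ?X q * (\<Omega> k (q + s) - \<Omega> k q)\<^sup>2"
    have di: "integrable lborel (\<lambda>q. \<Sum>k\<in>K. \<omega> k * ?d k s q)" for s
      by (intro Bochner_Integration.integrable_sum Bochner_Integration.integrable_mult_right
          integrable_cutoff_difference_square meas p)
    have dI: "(\<Sum>k\<in>K. \<omega> k * (t\<^sup>2 * L k t)) \<le> (LINT q|lborel. (\<Sum>k\<in>K. \<omega> k * ?d k s q))"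
      if "s = h \<or> s = - h" for s
    proof -
      have "(LINT q|lborel. (\<Sum>k\<in>K. \<omega> k * ?d k s q)) = (\<Sum>k\<in>K. \<omega> k * (LINT q|lborel. ?d k s q))"
        by (subst Bochner_Integration.integral_sum)
          (auto intro!: integrable_cutoff_difference_square meas p)
      moreover have "(\<Sum>k\<in>K. \<omega> k * (t\<^sup>2 * L k t)) \<le> (\<Sum>k\<in>K. \<omega> k * (LINT q|lborel. ?d k s q))"
        using CR[OF _ t] that by (intro sum_mono mult_left_mono \<omega>) (auto simp: h_def)
      ultimately show ?thesis by simp
    qed
    have fi: "integrable lborel (\<lambda>q. ?X q * (?f (q + h) + ?f (q - h) - 2 * ?f q))"
      by (rule cutoff_integral_second_difference_le(1)[OF f R h])
    have pt: "2 * t\<^sup>2 * S n q \<le> ?X q * (?f (q + h) + ?f (q - h) - 2 * ?f q)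
        - (\<Sum>k\<in>K. \<omega> k * ?d k h q) - (\<Sum>k\<in>K. \<omega> k * ?d k (- h) q)" for q
    proof -
      have "2 * (F (q + h, q) + F (q - h, q) - 2 * F (q, q))
        \<le> ?f (q + h) + ?f (q - h) - 2 * ?f q
          - (\<Sum>k\<in>K. \<omega> k * (\<Omega> k (q + h) - \<Omega> k q)\<^sup>2) - (\<Sum>k\<in>K. \<omega> k * (\<Omega> k (q + - h) - \<Omega> k q)\<^sup>2)"
        using deficit[of "q + h" q] deficit[of "q + - h" q] by simp
      from mult_left_mono[OF this cutoff_nonneg[of R q]]
      have "?X q * (2 * (F (q + h, q) + F (q - h, q) - 2 * F (q, q)))
        \<le> ?X q * (?f (q + h) + ?f (q - h) - 2 * ?f q)
        - (\<Sum>k\<in>K. \<omega> k * ?d k h q) - (\<Sum>k\<in>K. \<omega> k * ?d k (- h) q)"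
        by (simp add: right_diff_distrib sum_distrib_left mult.left_commute)
      moreover have "2 * t\<^sup>2 * S n q = ?X q * (2 * (F (q + h, q) + F (q - h, q) - 2 * F (q, q)))"
        using t by (simp add: S_def h_def t_def)
      ultimately show ?thesis by simp
    qed
    have "2 * t\<^sup>2 * (LINT q|lborel. S n q) = (LINT q|lborel. 2 * t\<^sup>2 * S n q)" by simp
    also have "\<dots> \<le> (LINT q|lborel. ?X q * (?f (q + h) + ?f (q - h) - 2 * ?f q)
        - (\<Sum>k\<in>K. \<omega> k * ?d k h q) - (\<Sum>k\<in>K. \<omega> k * ?d k (- h) q))"
      using Sint[of n] fi di[of h] di[of "- h"] pt
      by (intro integral_mono Bochner_Integration.integrable_diff Bochner_Integration.integrable_mult_right) auto
    also have "\<dots> = (LINT q|lborel. ?X q * (?f (q + h) + ?f (q - h) - 2 * ?f q))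
        - (LINT q|lborel. (\<Sum>k\<in>K. \<omega> k * ?d k h q)) - (LINT q|lborel. (\<Sum>k\<in>K. \<omega> k * ?d k (- h) q))"
      using fi di[of h] di[of "- h"]
      by (simp only: Bochner_Integration.integral_diff Bochner_Integration.integrable_diff)
    also have "\<dots> \<le> 34 * (norm h / R)\<^sup>2 * ?If - 2 * (\<Sum>k\<in>K. \<omega> k * (t\<^sup>2 * L k t))"
      using cutoff_integral_second_difference_le(2)[OF f R h] dI[OF disjI1[OF refl]] dI[OF disjI2[OF refl]] by linarith
    also have "\<dots> = 2 * t\<^sup>2 * (17 * (norm r / R)\<^sup>2 * ?If - (\<Sum>k\<in>K. \<omega> k * L k t))"
    proof -
      have "(norm h / R)\<^sup>2 = t\<^sup>2 * (norm r / R)\<^sup>2"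
        using t by (simp add: h_def power_mult_distrib power_divide)
      moreover have "(\<Sum>k\<in>K. \<omega> k * (t\<^sup>2 * L k t)) = t\<^sup>2 * (\<Sum>k\<in>K. \<omega> k * L k t)"
        by (simp add: sum_distrib_left mult.left_commute)
      ultimately show ?thesis by (simp add: right_diff_distrib)
    qed
    finally show ?thesis using t by (simp add: t_def)
  qed
  have Llim: "(\<lambda>n. 17 * (norm r / R)\<^sup>2 * ?If - (\<Sum>k\<in>K. \<omega> k * L k (T n)))
      \<longlonglongrightarrow> 17 * (norm r / R)\<^sup>2 * ?If - (\<Sum>k\<in>K. \<omega> k * L k 0)"
    unfolding L_def by (intro tendsto_intros Tl)
  have "(LINT q|lborel. ?X q * DDF (q, q) (r, 0) (r, 0))
      \<le> 17 * (norm r / R)\<^sup>2 * ?If - (\<Sum>k\<in>K. \<omega> k * L k 0)"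
    using LIMSEQ_le[OF Slim Llim] step by blast
  then show "(LINT q|lborel. ?X q * DDF (q, q) (r, 0) (r, 0))
      \<le> 17 * (norm r / R)\<^sup>2 * ?If
        - (\<Sum>k\<in>K. \<omega> k * (2 * \<sigma> k * (- (w k \<bullet> r) * (LINT q|lborel. ?X q * (\<Omega> k q)\<^sup>2))
            - 2 * \<bar>\<sigma> k\<bar> * (4 / R * norm r * (LINT q|lborel. \<bar>u k q\<bar> * (\<Omega> k q)\<^sup>2))
            - 4 * (\<sigma> k)\<^sup>2 * (LINT q|lborel. (u k q)\<^sup>2 * (\<Omega> k q)\<^sup>2)))"
    by (simp add: L_def P_def A_def v_def mult.assoc)
qed

section \<open>Removal of the cutoff and summation over the states\<close>

lemma cutoff_integral_tendsto:
  fixes g :: "'a::euclidean_space \<Rightarrow> real"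
  assumes g: "integrable lborel g"
  shows "(\<lambda>n. LINT q|lborel. cutoff (real (Suc n)) q * g q) \<longlonglongrightarrow> (LINT q|lborel. g q)"
proof (rule integral_dominated_convergence[where w = "\<lambda>q. \<bar>g q\<bar>"])
  show "AE q in lborel. (\<lambda>n. cutoff (real (Suc n)) q * g q) \<longlonglongrightarrow> g q"
    using tendsto_mult[OF cutoff_tendsto_1 tendsto_const, of _ "g _"] by (intro AE_I2) simp
  show "AE q in lborel. norm (cutoff (real (Suc n)) q * g q) \<le> \<bar>g q\<bar>" for n
    by (intro AE_I2) (simp add: abs_mult cutoff_nonneg cutoff_le_1 mult_left_le_one_le)
qed (use g in auto)

text \<open>Time is fixed, so \<open>\<rho>\<close> has no argument \<open>t\<close>. Summability
  belongs to the conclusion because otherwise the infinite sum would carry no information. Indices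
  of weight zero contribute zero to the kernel series and to the bound.\<close>

theorem theorem3:
  fixes hbar :: real
    and M :: "real^'n^'n"
    and \<omega> :: "nat \<Rightarrow> real"
    and \<psi> :: "nat \<Rightarrow> real^'n \<Rightarrow> complex"
    and \<rho> :: "real^'n \<Rightarrow> real^'n \<Rightarrow> complex"
  assumes hbar_pos: "hbar > 0"
    and M_spd: "sym_posdef M"
    (* spectral decomposition  rho = sum_k omega_k |psi_k><psi_k| *)
    and w_nonneg: "\<And>k. \<omega> k \<ge> 0"
    and w_sum: "\<omega> sums 1"
    and orthonormal: "\<And>j k. \<omega> j > 0 \<Longrightarrow> \<omega> k > 0 \<Longrightarrow>
          integrable lborel (\<lambda>q. \<psi> j q * cnj (\<psi> k q)) \<and>
          (LINT q|lborel. \<psi> j q * cnj (\<psi> k q)) = (if j = k then 1 else 0)"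
    and kernel: "\<And>q q'. (\<lambda>k. complex_of_real (\<omega> k) * \<psi> k q * cnj (\<psi> k q')) sums \<rho> q q'"
    (* regularity of  Omega-bar(q,q') = |<q|rho|q'>|  on R^{2n} *)
    and Omb_C2: "C2 (\<lambda>z :: (real^'n) \<times> (real^'n). cmod (\<rho> (fst z) (snd z)))"
    and Omb_vanish: "\<And>e. e > 0 \<Longrightarrow> \<exists>R. \<forall>q q'. norm q \<ge> R \<or> norm q' \<ge> R \<longrightarrow>
          cmod (\<rho> q q') < e"
    and Omb_norm: "integrable lborel (\<lambda>q. cmod (\<rho> q q)) \<and> (LINT q|lborel. cmod (\<rho> q q)) = 1"
    (* regularity of  Omega_k = |psi_k| *)
    and Om_C2: "\<And>k. \<omega> k > 0 \<Longrightarrow> C2 (\<lambda>q. cmod (\<psi> k q))"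
    and Om_vanish: "\<And>k. \<omega> k > 0 \<Longrightarrow> ((\<lambda>q. cmod (\<psi> k q)) \<longlongrightarrow> 0) at_infinity"
    (* finite second moments, so that V^(k) exists; V^(k) positive definite *)
    and moments: "\<And>k i j. \<omega> k > 0 \<Longrightarrow>
          integrable lborel (\<lambda>q. q $ i * q $ j * (cmod (\<psi> k q))\<^sup>2) \<and>
          integrable lborel (\<lambda>q. q $ i * (cmod (\<psi> k q))\<^sup>2)"
    and V_posdef: "\<And>k. \<omega> k > 0 \<Longrightarrow> sym_posdef (pos_cov (\<psi> k))"
    (* the mean value of the quantum potential exists *)
    and Q_integrable: "integrable lborel (\<lambda>q. M_laplacian M (\<lambda>y. cmod (\<rho> y q)) q)"
  shows "summable (\<lambda>k. \<omega> k * largest_eigenvalue (matrix_inv (pos_cov (\<psi> k)) ** M)) \<and>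
         (hbar\<^sup>2 / 8) * (\<Sum>k. \<omega> k * largest_eigenvalue (matrix_inv (pos_cov (\<psi> k)) ** M))
           \<le> mean_quantum_potential hbar M (\<lambda>q q'. cmod (\<rho> q q'))"
proof -
  define F where "F z = cmod (\<rho> (fst z) (snd z))" for z
  obtain DF DDF where D: "\<And>z. (F has_derivative blinfun_apply (DF z)) (at z)"
    and DD: "\<And>z. (DF has_derivative blinfun_apply (DDF z)) (at z)"
    and cont: "continuous_on UNIV DDF"
    using Omb_C2 unfolding C2_def F_def [symmetric] by blast
  have symM: "transpose M = M" and posM: "\<And>x. 0 \<le> x \<bullet> (M *v x)"
    using M_spd by (auto simp: sym_posdef_def) (metis inner_zero_left order_less_imp_le order_refl)
  obtain m r where r: "\<And>i j. M $ i $ j = (\<Sum>l<(m::nat). r l $ i * r l $ j)"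
    using psd_sum_of_rank_one[OF symM posM] by blast
  have quad: "x \<bullet> (M *v x) = (\<Sum>l<m. (x \<bullet> r l)\<^sup>2)" for x
  proof -
    have "x \<bullet> (M *v x) = (\<Sum>i\<in>UNIV. \<Sum>j\<in>UNIV. \<Sum>l<m. (x $ i * r l $ i) * (x $ j * r l $ j))"
      by (simp add: inner_vec_def matrix_vector_mult_def r sum_distrib_left sum_distrib_right mult_ac)
    also have "\<dots> = (\<Sum>i\<in>UNIV. \<Sum>l<m. \<Sum>j\<in>UNIV. (x $ i * r l $ i) * (x $ j * r l $ j))"
      by (intro sum.cong refl sum.swap)
    also have "\<dots> = (\<Sum>l<m. \<Sum>i\<in>UNIV. \<Sum>j\<in>UNIV. (x $ i * r l $ i) * (x $ j * r l $ j))"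
      by (rule sum.swap)
    also have "\<dots> = (\<Sum>l<m. (x \<bullet> r l)\<^sup>2)"
      by (simp add: inner_vec_def power2_eq_square sum_product)
    finally show ?thesis .
  qed
  define lap where "lap q = M_laplacian M (\<lambda>y. cmod (\<rho> y q)) q" for q
  have lap: "lap q = (\<Sum>l<m. DDF (q, q) (r l, 0) (r l, 0))" for q
    using M_laplacian_eq_sum_second_derivatives[OF D DD r, of q q] by (simp add: lap_def F_def)
  define lam where "lam k = largest_eigenvalue (matrix_inv (pos_cov (\<psi> k)) ** M)" for k
  have "\<exists>v. \<omega> k > 0 \<longrightarrow> v \<noteq> 0 \<and> M *v v = lam k *\<^sub>R (pos_cov (\<psi> k) *v v) \<and> lam k > 0" for k
    unfolding lam_def using largest_eigenvalue_generalized[OF M_spd V_posdef] by metis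
  then obtain w where w: "\<And>k. \<omega> k > 0 \<Longrightarrow> w k \<noteq> 0"
      "\<And>k. \<omega> k > 0 \<Longrightarrow> M *v w k = lam k *\<^sub>R (pos_cov (\<psi> k) *v w k)"
      "\<And>k. \<omega> k > 0 \<Longrightarrow> lam k > 0"
    by metis
  have p: "integrable lborel (\<lambda>q. (cmod (\<psi> k q))\<^sup>2)" "(LINT q|lborel. (cmod (\<psi> k q))\<^sup>2) = 1"
    if "\<omega> k > 0" for k
  proof -
    have e: "\<psi> k q * cnj (\<psi> k q) = complex_of_real ((cmod (\<psi> k q))\<^sup>2)" for q
      by (rule complex_norm_square [symmetric])
    from orthonormal[OF that that]
    show "integrable lborel (\<lambda>q. (cmod (\<psi> k q))\<^sup>2)" "(LINT q|lborel. (cmod (\<psi> k q))\<^sup>2) = 1"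
      unfolding e complex_of_real_integrable_eq integral_complex_of_real by (auto simp flip: of_real_power)
  qed
  define c where "c k = (\<Sum>i\<in>UNIV. w k $ i * (LINT q|lborel. q $ i * (cmod (\<psi> k q))\<^sup>2))" for k
  define u where "u k q = w k \<bullet> q - c k" for k q
  define v where "v k = w k \<bullet> (pos_cov (\<psi> k) *v w k)" for k
  have vpos: "v k > 0" if "\<omega> k > 0" for k
    using V_posdef[OF that] w(1)[OF that] by (simp add: v_def sym_posdef_def)
  have cm: "integrable lborel (\<lambda>q. u k q * (cmod (\<psi> k q))\<^sup>2)"
      "(LINT q|lborel. u k q * (cmod (\<psi> k q))\<^sup>2) = 0"
      "integrable lborel (\<lambda>q. (u k q)\<^sup>2 * (cmod (\<psi> k q))\<^sup>2)"
      "(LINT q|lborel. (u k q)\<^sup>2 * (cmod (\<psi> k q))\<^sup>2) = v k" if "\<omega> k > 0" for k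
    using centered_moments[OF p[OF that], of "w k"] moments[OF that]
    by (simp_all add: u_def c_def v_def)
  have meas: "(\<lambda>q. cmod (\<psi> k q)) \<in> borel_measurable borel" if "\<omega> k > 0" for k
  proof -
    have "continuous_on UNIV (\<lambda>q. cmod (\<psi> k q))"
      using Om_C2[OF that] unfolding C2_def
      by (meson continuous_at_imp_continuous_on has_derivative_continuous)
    then show ?thesis by (rule borel_measurable_continuous_onI)
  qed
  \<comment> \<open>For finitely many states the errors in \<open>1 / R\<close> vanish term by term
    as the radius grows. The full series is recovered afterwards from its bounded partial
    sums.\<close>
  have main: "(LINT q|lborel. lap q) \<le> - (1 / 4) * (\<Sum>k\<in>K. \<omega> k * lam k)"
    if K: "finite K" "\<And>k. k \<in> K \<Longrightarrow> \<omega> k > 0" for K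
  proof -
    \<comment> \<open>the multiplier that is optimal in the limit of vanishing step and infinite cutoff radius\<close>
    define \<sigma> where "\<sigma> l k = - (w k \<bullet> r l) / (4 * v k)" for l k
    define B where "B l n = 17 * (norm (r l) / real (Suc n))\<^sup>2 * (LINT q|lborel. F (q, q))
        - (\<Sum>k\<in>K. \<omega> k * (2 * \<sigma> l k * (- (w k \<bullet> r l)
              * (LINT q|lborel. cutoff (real (Suc n)) q * (cmod (\<psi> k q))\<^sup>2))
            - 2 * \<bar>\<sigma> l k\<bar> * (4 / real (Suc n) * norm (r l) * (LINT q|lborel. \<bar>u k q\<bar> * (cmod (\<psi> k q))\<^sup>2))
            - 4 * (\<sigma> l k)\<^sup>2 * v k))" for l n
    have f: "integrable lborel (\<lambda>q. F (q, q))" "\<And>q. 0 \<le> F (q, q)"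
      using Omb_norm by (auto simp: F_def)
    have deficit: "(\<Sum>k\<in>K. \<omega> k * (cmod (\<psi> k x) - cmod (\<psi> k y))\<^sup>2) \<le> F (x, x) + F (y, y) - 2 * F (x, y)" for x y
      using density_kernel_deficit[OF w_nonneg kernel K(1)] by (simp add: F_def)
    note bound = cutoff_second_derivative_bound[where K = K and \<omega> = \<omega> and \<Omega> = "\<lambda>k q. cmod (\<psi> k q)"
        and u = u and w = w and c = c, OF D DD cont f w_nonneg deficit meas u_def p cm(1-3), OF K(2) K(2) K(2) K(2) K(2) K(2)]
    have bint: "integrable lborel (\<lambda>q. cutoff (real (Suc n)) q * DDF (q, q) (r l, 0) (r l, 0))" for l n
      by (rule bound(1)) auto
    have b: "(LINT q|lborel. cutoff (real (Suc n)) q * DDF (q, q) (r l, 0) (r l, 0)) \<le> B l n" for l n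
    proof -
      have "(\<Sum>k\<in>K. \<omega> k * (a k - 4 * (\<sigma> l k)\<^sup>2 * (LINT q|lborel. (u k q)\<^sup>2 * (cmod (\<psi> k q))\<^sup>2)))
          = (\<Sum>k\<in>K. \<omega> k * (a k - 4 * (\<sigma> l k)\<^sup>2 * v k))" for a
        using cm(4) K(2) by (intro sum.cong) auto
      then show ?thesis
        using bound(2)[of "real (Suc n)" "r l" "\<sigma> l"] by (simp only: B_def)
    qed
    \<comment> \<open>The directions are summed while the cutoff is present: integrability without
      cutoff is known for \<open>lap\<close> as a whole, not for its separate terms.\<close>
    have le: "(LINT q|lborel. cutoff (real (Suc n)) q * lap q) \<le> (\<Sum>l<m. B l n)" for n
    proof -
      have "(LINT q|lborel. cutoff (real (Suc n)) q * lap q)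
          = (\<Sum>l<m. LINT q|lborel. cutoff (real (Suc n)) q * DDF (q, q) (r l, 0) (r l, 0))"
        unfolding lap sum_distrib_left by (rule Bochner_Integration.integral_sum, rule bint)
      also have "\<dots> \<le> (\<Sum>l<m. B l n)" by (intro sum_mono b)
      finally show ?thesis .
    qed
    have lim: "(\<lambda>n. LINT q|lborel. cutoff (real (Suc n)) q * lap q) \<longlonglongrightarrow> (LINT q|lborel. lap q)"
      using Q_integrable by (intro cutoff_integral_tendsto) (simp add: lap_def [abs_def])
    have Blim: "(\<lambda>n. \<Sum>l<m. B l n) \<longlonglongrightarrow> (\<Sum>l<m. 17 * 0\<^sup>2 * (LINT q|lborel. F (q, q))
        - (\<Sum>k\<in>K. \<omega> k * (2 * \<sigma> l k * (- (w k \<bullet> r l) * 1)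
            - 2 * \<bar>\<sigma> l k\<bar> * (0 * norm (r l) * (LINT q|lborel. \<bar>u k q\<bar> * (cmod (\<psi> k q))\<^sup>2))
            - 4 * (\<sigma> l k)\<^sup>2 * v k)))"
      unfolding B_def
    proof (intro tendsto_intros LIMSEQ_Suc[OF lim_const_over_n])
      fix k assume k: "k \<in> K"
      show "(\<lambda>n. LINT q|lborel. cutoff (real (Suc n)) q * (cmod (\<psi> k q))\<^sup>2) \<longlonglongrightarrow> 1"
        using cutoff_integral_tendsto[OF p(1)[OF K(2)[OF k]]] p(2)[OF K(2)[OF k]] by simp
    qed
    have "(LINT q|lborel. lap q) \<le> (\<Sum>l<m. 17 * 0\<^sup>2 * (LINT q|lborel. F (q, q))
        - (\<Sum>k\<in>K. \<omega> k * (2 * \<sigma> l k * (- (w k \<bullet> r l) * 1)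
            - 2 * \<bar>\<sigma> l k\<bar> * (0 * norm (r l) * (LINT q|lborel. \<bar>u k q\<bar> * (cmod (\<psi> k q))\<^sup>2))
            - 4 * (\<sigma> l k)\<^sup>2 * v k)))"
      by (rule LIMSEQ_le[OF lim Blim]) (use le in blast)
    also have "\<dots> = (\<Sum>l<m. - (\<Sum>k\<in>K. \<omega> k * ((w k \<bullet> r l)\<^sup>2 / (4 * v k))))"
    proof (intro sum.cong refl)
      fix l
      \<comment> \<open>With \<open>a = w k . r l\<close>, the quadratic
        \<open>- 2 s a - 4 s^2 v\<close> attains its maximum \<open>a^2 / (4 v)\<close> at
        \<open>s = - a / (4 v)\<close>.\<close>
      have "2 * \<sigma> l k * (- (w k \<bullet> r l) * 1) - 4 * (\<sigma> l k)\<^sup>2 * v k = (w k \<bullet> r l)\<^sup>2 / (4 * v k)"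
        if "k \<in> K" for k
        using vpos[OF K(2)[OF that]] by (simp add: \<sigma>_def field_simps power2_eq_square)
      then show "17 * 0\<^sup>2 * (LINT q|lborel. F (q, q))
        - (\<Sum>k\<in>K. \<omega> k * (2 * \<sigma> l k * (- (w k \<bullet> r l) * 1)
            - 2 * \<bar>\<sigma> l k\<bar> * (0 * norm (r l) * (LINT q|lborel. \<bar>u k q\<bar> * (cmod (\<psi> k q))\<^sup>2))
            - 4 * (\<sigma> l k)\<^sup>2 * v k)) = - (\<Sum>k\<in>K. \<omega> k * ((w k \<bullet> r l)\<^sup>2 / (4 * v k)))"
        by simp
    qed
    also have "\<dots> = - (\<Sum>k\<in>K. \<Sum>l<m. \<omega> k * ((w k \<bullet> r l)\<^sup>2 / (4 * v k)))"
      by (simp add: sum_negf) (rule sum.swap)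
    \<comment> \<open>By \<open>quad\<close> the squares reassemble to the form of \<open>M\<close>
      at \<open>w k\<close>, which the eigenvector equation makes \<open>lam k * v k\<close>; the
      variance \<open>v k\<close> cancels.\<close>
    also have "(\<Sum>k\<in>K. \<Sum>l<m. \<omega> k * ((w k \<bullet> r l)\<^sup>2 / (4 * v k))) = (\<Sum>k\<in>K. (1 / 4) * (\<omega> k * lam k))"
    proof (rule sum.cong[OF refl])
      fix k assume "k \<in> K"
      then have k: "\<omega> k > 0" by (rule K(2))
      have "(\<Sum>l<m. \<omega> k * ((w k \<bullet> r l)\<^sup>2 / (4 * v k))) = \<omega> k * ((w k \<bullet> (M *v w k)) / (4 * v k))"
        by (simp add: quad sum_distrib_left sum_divide_distrib)
      also have "w k \<bullet> (M *v w k) = lam k * v k"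
        using w(2)[OF k] by (simp add: v_def)
      finally show "(\<Sum>l<m. \<omega> k * ((w k \<bullet> r l)\<^sup>2 / (4 * v k))) = (1 / 4) * (\<omega> k * lam k)"
        using vpos[OF k] by simp
    qed
    finally show ?thesis by (simp add: sum_divide_distrib)
  qed
  have partial: "(\<Sum>k<N. \<omega> k * lam k) \<le> - 4 * (LINT q|lborel. lap q)" for N
  proof -
    have "(\<Sum>k<N. \<omega> k * lam k) = (\<Sum>k\<in>{k. k < N \<and> \<omega> k > 0}. \<omega> k * lam k)"
    proof (rule sum.mono_neutral_right)
      have "\<omega> k = 0" if "\<not> 0 < \<omega> k" for k
        using that w_nonneg[of k] by linarith
      then show "\<forall>k\<in>{..<N} - {k. k < N \<and> 0 < \<omega> k}. \<omega> k * lam k = 0" by auto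
    qed auto
    also have "\<dots> \<le> - 4 * (LINT q|lborel. lap q)"
    proof -
      have "(LINT q|lborel. lap q) \<le> - (1 / 4) * (\<Sum>k\<in>{k. k < N \<and> \<omega> k > 0}. \<omega> k * lam k)"
        by (rule main) auto
      then show ?thesis by linarith
    qed
    finally show ?thesis .
  qed
  have nonneg: "0 \<le> \<omega> k * lam k" for k
    using w_nonneg[of k] w(3)[of k] by (cases "\<omega> k = 0") auto
  have summable: "summable (\<lambda>k. \<omega> k * lam k)"
    by (rule summableI_nonneg_bounded[OF nonneg partial])
  then have "(\<Sum>k. \<omega> k * lam k) \<le> - 4 * (LINT q|lborel. lap q)"
    using suminf_le_const partial by blast
  \<comment> \<open>The factor 4 turns \<open>hbar^2 / 8\<close> into the prefactor
    \<open>hbar^2 / 2\<close> of \<open>mean_quantum_potential\<close>.\<close>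
  then have "hbar\<^sup>2 / 8 * (\<Sum>k. \<omega> k * lam k) \<le> hbar\<^sup>2 / 8 * (- 4 * (LINT q|lborel. lap q))"
    by (intro mult_left_mono) auto
  also have "\<dots> = mean_quantum_potential hbar M (\<lambda>q q'. cmod (\<rho> q q'))"
    by (simp add: mean_quantum_potential_def lap_def)
  finally show ?thesis using summable by (simp add: lam_def)
qed

end
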